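(* For every topological group $G$, the following are equivalent: \begin{enumerate} \item $G \cong \operatorname{Iso}(U)$ for some Polish ultrametric Urysohn space $U$; \item $G \cong \operatorname{Iso}(U)$ for some homogeneous wide Polish ultrametric space $U$; \item $G \cong \operatorname{Wr}^{\operatorname{LF}}_{\delta \in \Delta} \operatorname{Sym}(N_\delta)$ for some quasi-maximal countable linear skeleton $\langle \Delta,N \rangle$; \item $G \cong \operatorname{Wr}^{\operatorname{LF}}_{\delta \in \Delta} \operatorname{Sym}(N_\delta)$ or $G \cong \operatorname{Wr}^{\operatorname{Fin}}_{\delta \in \Delta} \operatorname{Sym}(N_\delta)$, where the latter is equipped with the topology $\tau^*$, for some maximal countable linear skeleton $\langle \Delta,N \rangle$. \end{enumerate}
   Context: $\cong$ denotes isomorphism of topological groups; $\operatorname{Iso}(U)$ is the isometry group with the pointwise convergence topology. A Polish ultrametric space is a separable complete metric space with $d(x,z)\le\max\{d(x,y),d(y,z)\}$; its distance set is $D=\{d(x,y):x\neq y\}$ (always countable). It is homogeneous if $\operatorname{Iso}(U)$ acts transitively on $U$; it is wide if for every $r\in D$ it contains a countably infinite subset all of whose distinct points are at distance exactly $r$. A Polish ultrametric Urysohn space is a Polish ultrametric space $U$ with distance set $D$ which is ultrahomogeneous (every isometry between finite subsets of $U$ extends to an isometry of $U$) and universal for Polish ultrametric spaces whose distance set is contained in $D$ (each such space isometrically embeds into $U$). A skeleton $\langle\Delta,N\rangle$ is a nonempty partial order $\Delta$ with nonzero cardinals $N_\delta$ ($\delta\in\Delta$), each identified with the set of smaller ordinals;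 countable if $\Delta$ countable and $N_\delta\le\omega$; linear if $\Delta$ is linearly ordered; maximal if $N_\delta=\omega$ for all $\delta$; quasi-maximal if $N_\delta\in\{1,\omega\}$ for all $\delta$. For $x\in\prod_{\delta}N_\delta$, $x|_\delta$ is the restriction to $\{\gamma:\gamma\ge\delta\}$ and $\operatorname{supp}(x)=\{\gamma:x(\gamma)\ne0\}$. $\operatorname{Fin}$ = finite subsets of $\Delta$; $\operatorname{LF}$ = sets $A\subseteq\Delta$ with $A\cap\{\gamma:\gamma\ge\delta\}$ finite for every $\delta$. For $\mathscr{A}\in\{\operatorname{Fin},\operatorname{LF}\}$, $S^{\mathscr{A}}=\{x\in\prod_\delta N_\delta:\operatorname{supp}(x)\in\mathscr{A}\}$ and $\operatorname{Wr}^{\mathscr{A}}_{\delta\in\Delta}\operatorname{Sym}(N_\delta)$ is the group of $g\in\operatorname{Sym}(S^{\mathscr{A}})$ such that for all $x,y\in S^{\mathscr{A}}$ and $\delta$: $x|_\delta=y|_\delta\iff g(x)|_\delta=g(y)|_\delta$. Unless stated otherwise, it carries the pointwise convergence topology with respect to the topology on $S^{\mathscr{A}}$ generated by the sets $\{y:y|_\gamma=x|_\gamma\}$. The topology $\tau^*$ on $\operatorname{Wr}^{\operatorname{Fin}}$ (for countable skeletons, where $S^{\operatorname{Fin}}$ is countable) is the pointwise convergence topology with respect to the discrete topology on $S^{\operatorname{Fin}}$.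
   Formalization: Item (4) also allows G to be trivial: the trivial group satisfies (1)–(3) via the one-point space, but not (4), as skeletons are nonempty. Polish ultrametric spaces are taken with points in ℕ^ℕ; each has an isometric copy there. *)

theory Defs
  imports "HOL-Analysis.Analysis" "HOL-Algebra.Bij"
begin

section \<open>Topological groups\<close>

definition topological_group :: "('a, 'm) monoid_scheme \<Rightarrow> 'a topology \<Rightarrow> bool" where
  "topological_group G T \<longleftrightarrow>
     group G \<and> topspace T = carrier G \<and>
     continuous_map (prod_topology T T) T (\<lambda>(x, y). x \<otimes>\<^bsub>G\<^esub> y) \<and>
     continuous_map T T (\<lambda>x. inv\<^bsub>G\<^esub> x)"

definition top_group_isomorphic ::
    "('a, 'm) monoid_scheme \<Rightarrow> 'a topology \<Rightarrow> ('b, 'n) monoid_scheme \<Rightarrow> 'b topology \<Rightarrow> bool" where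
  "top_group_isomorphic G T H T' \<longleftrightarrow> (\<exists>h \<in> iso G H. homeomorphic_map T T' h)"

text \<open>Self-maps of a set \<open>S\<close> are taken extensional (\<^term>\<open>undefined\<close> outside \<open>S\<close>), as in
  \<^const>\<open>BijGroup\<close>, so that they are determined by their values on \<open>S\<close>.\<close>

definition pointwise_topology :: "'a topology \<Rightarrow> ('a \<Rightarrow> 'a) set \<Rightarrow> ('a \<Rightarrow> 'a) topology" where
  "pointwise_topology X F = subtopology (product_topology (\<lambda>_. X) (topspace X)) F"


section \<open>Polish ultrametric spaces\<close>

definition preserves_dist :: "'a metric \<Rightarrow> 'b metric \<Rightarrow> 'a set \<Rightarrow> ('a \<Rightarrow> 'b) \<Rightarrow> bool" where
  "preserves_dist U V A f \<longleftrightarrow> (\<forall>x\<in>A. \<forall>y\<in>A. mdist V (f x) (f y) = mdist U x y)"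

definition isometries :: "'a metric \<Rightarrow> ('a \<Rightarrow> 'a) set" where
  "isometries U = {g \<in> Bij (mspace U). preserves_dist U U (mspace U) g}"

definition Iso_group :: "'a metric \<Rightarrow> ('a \<Rightarrow> 'a) monoid" where
  "Iso_group U = (BijGroup (mspace U))\<lparr>carrier := isometries U\<rparr>"

definition Iso_topology :: "'a metric \<Rightarrow> ('a \<Rightarrow> 'a) topology" where
  "Iso_topology U = pointwise_topology (mtopology_of U) (isometries U)"

definition distance_set :: "'a metric \<Rightarrow> real set" where
  "distance_set U = {mdist U x y | x y. x \<in> mspace U \<and> y \<in> mspace U \<and> x \<noteq> y}"

definition Polish_ultrametric :: "'a metric \<Rightarrow> bool" where
  "Polish_ultrametric U \<longleftrightarrow>
     separable_space (mtopology_of U) \<and> mcomplete_of U \<and>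
     (\<forall>x\<in>mspace U. \<forall>y\<in>mspace U. \<forall>z\<in>mspace U.
        mdist U x z \<le> max (mdist U x y) (mdist U y z))"

definition homogeneous :: "'a metric \<Rightarrow> bool" where
  "homogeneous U \<longleftrightarrow> (\<forall>x\<in>mspace U. \<forall>y\<in>mspace U. \<exists>g\<in>isometries U. g x = y)"

definition wide :: "'a metric \<Rightarrow> bool" where
  "wide U \<longleftrightarrow>
     (\<forall>r\<in>distance_set U. \<exists>A\<subseteq>mspace U. countable A \<and> infinite A \<and>
        (\<forall>x\<in>A. \<forall>y\<in>A. x \<noteq> y \<longrightarrow> mdist U x y = r))"

definition ultrahomogeneous :: "'a metric \<Rightarrow> bool" where
  "ultrahomogeneous U \<longleftrightarrow>
     (\<forall>A B f. finite A \<and> A \<subseteq> mspace U \<and> finite B \<and> B \<subseteq> mspace U \<and>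
        f ` A = B \<and> preserves_dist U U A f \<longrightarrow>
        (\<exists>g\<in>isometries U. \<forall>x\<in>A. g x = f x))"

text \<open>Quantification over all Polish ultrametric spaces is quantification over those whose points
  are functions \<open>nat \<Rightarrow> nat\<close>; by the lemma following the definition, every Polish ultrametric
  space, over any type, is isometric to one of these.\<close>

definition Urysohn :: "'a metric \<Rightarrow> bool" where
  "Urysohn U \<longleftrightarrow>
     Polish_ultrametric U \<and> ultrahomogeneous U \<and>
     (\<forall>X :: (nat \<Rightarrow> nat) metric.
        Polish_ultrametric X \<and> distance_set X \<subseteq> distance_set U \<longrightarrow>
        (\<exists>f \<in> mspace X \<rightarrow> mspace U. preserves_dist X U (mspace X) f))"

lemma Polish_ultrametric_nat_fun_copy:
  fixes U :: "'a metric"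
  assumes U: "Polish_ultrametric U"
  shows "\<exists>(V :: (nat \<Rightarrow> nat) metric) f. Polish_ultrametric V \<and>
           bij_betw f (mspace U) (mspace V) \<and> preserves_dist U V (mspace U) f"
proof -
  interpret U: Metric_space "mspace U" "mdist U" by simp
  have topU: "mtopology_of U = U.mtopology" by (simp add: mtopology_of_def)
  obtain C where C: "countable C" "C \<subseteq> mspace U" "U.mtopology closure_of C = mspace U"
    using U by (auto simp: Polish_ultrametric_def separable_space_def topU)
  have dense: "\<exists>c\<in>C. mdist U x c < e" if "x \<in> mspace U" "e > 0" for x e
  proof -
    have "x \<in> U.mtopology closure_of C" using that C by simp
    with that(2) show ?thesis by (auto simp: U.metric_closure_of)
  qed
  define c where "c = from_nat_into C"
  define f :: "'a \<Rightarrow> nat \<Rightarrow> nat" where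
    "f x k = (case prod_decode k of (n, m) \<Rightarrow>
                if mdist U x (c n) < inverse (real (Suc m)) then 1 else 0)" for x k
  have inj: "inj_on f (mspace U)"
  proof (rule inj_onI, rule ccontr)
    fix x y assume x: "x \<in> mspace U" and y: "y \<in> mspace U" and eq: "f x = f y" and "x \<noteq> y"
    then have "mdist U x y / 2 > 0" using U.mdist_pos_less by simp
    then obtain m where m: "inverse (real (Suc m)) < mdist U x y / 2"
      using reals_Archimedean by blast
    obtain a where a: "a \<in> C" "mdist U x a < inverse (real (Suc m))"
      using dense[OF x, of "inverse (real (Suc m))"] by auto
    obtain n where n: "c n = a"
      using from_nat_into_surj[OF C(1) a(1)] unfolding c_def by blast
    have "f x (prod_encode (n, m)) = 1" using a n by (simp add: f_def)
    then have "f y (prod_encode (n, m)) = 1" using eq by simp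
    then have "mdist U y a < inverse (real (Suc m))"
      using n by (simp add: f_def split: if_splits)
    moreover have "mdist U x y \<le> mdist U x a + mdist U a y"
      using x y a(1) C(2) U.triangle by blast
    moreover have "mdist U a y = mdist U y a" by (rule U.commute)
    ultimately show False using a(2) m by linarith
  qed
  define h where "h = inv_into (mspace U) f"
  have hf: "h (f x) = x" if "x \<in> mspace U" for x
    using inj that by (simp add: h_def)
  define M where "M = f ` mspace U"
  define d where "d = (\<lambda>x y. mdist U (h x) (h y))"
  have hM: "h x \<in> mspace U" "f (h x) = x" if "x \<in> M" for x
    using that hf by (auto simp: M_def)
  interpret V: Metric_space M d
  proof
    show "d x y = 0 \<longleftrightarrow> x = y" if "x \<in> M" "y \<in> M" for x y
      using that hM by (metis U.zero d_def)
    show "d x z \<le> d x y + d y z" if "x \<in> M" "y \<in> M" "z \<in> M" for x y z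
      using that hM U.triangle by (simp add: d_def)
  qed (simp_all add: d_def U.commute)
  define V where "V = metric (M, d)"
  have V[simp]: "mspace V = M" "mdist V = d" "mtopology_of V = V.mtopology"
    "mcomplete_of V = V.mcomplete"
    by (simp_all add: V_def)
  have "separable_space V.mtopology"
    unfolding separable_space_def
  proof (intro exI conjI)
    show "countable (f ` C)" "f ` C \<subseteq> topspace V.mtopology"
      using C unfolding V.topspace_mtopology by (auto simp: M_def)
    have "y \<in> V.mtopology closure_of (f ` C)" if y: "y \<in> M" for y
    proof -
      have "\<exists>z\<in>f ` C. z \<in> V.mball y e" if e: "e > 0" for e
      proof -
        obtain a where a: "a \<in> C" "mdist U (h y) a < e" using dense hM(1)[OF y] e by blast
        then have "h (f a) = a" "f a \<in> M" using C hf by (auto simp: M_def)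
        moreover have "d y (f a) < e" using a calculation by (simp add: d_def)
        ultimately show ?thesis using a y by (intro bexI[of _ "f a"]) auto
      qed
      then show ?thesis using y by (auto simp: V.metric_closure_of)
    qed
    then show "V.mtopology closure_of (f ` C) = topspace V.mtopology"
      using closure_of_subset_topspace[of V.mtopology "f ` C"] by auto
  qed
  moreover have "V.mcomplete"
    unfolding V.mcomplete_def
  proof (intro allI impI)
    fix \<sigma> assume \<sigma>: "V.MCauchy \<sigma>"
    have \<sigma>M: "\<sigma> n \<in> M" for n using \<sigma> by (auto simp: V.MCauchy_def)
    have d: "d x y = mdist U (h x) (h y)" for x y by (simp add: d_def)
    have "U.MCauchy (h \<circ> \<sigma>)"
      using \<sigma> hM(1)[OF \<sigma>M] by (auto simp: V.MCauchy_def U.MCauchy_def d)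
    moreover have "U.mcomplete" using U by (simp add: Polish_ultrametric_def mcomplete_of_def)
    ultimately obtain x where x: "limitin U.mtopology (h \<circ> \<sigma>) x sequentially"
      unfolding U.mcomplete_def by blast
    then have "x \<in> mspace U" by (simp add: U.limit_metric_sequentially)
    then have "f x \<in> M" "h (f x) = x" using hf by (auto simp: M_def)
    then have "limitin V.mtopology \<sigma> (f x) sequentially"
      using x \<sigma>M by (auto simp: V.limit_metric_sequentially U.limit_metric_sequentially d) meson
    then show "\<exists>y. limitin V.mtopology \<sigma> y sequentially" by blast
  qed
  moreover have "\<forall>x\<in>M. \<forall>y\<in>M. \<forall>z\<in>M. d x z \<le> max (d x y) (d y z)"
    using U hM(1) by (auto simp: Polish_ultrametric_def d_def)
  ultimately have "Polish_ultrametric V" by (simp add: Polish_ultrametric_def)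
  moreover have "bij_betw f (mspace U) (mspace V)"
    using inj by (simp add: bij_betw_def M_def)
  moreover have "preserves_dist U V (mspace U) f"
    using hf by (simp add: preserves_dist_def d_def)
  ultimately show ?thesis by blast
qed


section \<open>Skeletons and generalized wreath products\<close>

text \<open>The cardinals \<open>N \<delta>\<close> of a countable skeleton are at most \<open>\<omega>\<close> and are given as elements of
  \<^typ>\<open>enat\<close>; as a set of ordinals, \<open>N \<delta>\<close> is \<open>{k. enat k < N \<delta>}\<close>. In the order relation \<open>r\<close>,
  \<open>(\<delta>, \<gamma>) \<in> r\<close> means \<open>\<delta> \<le> \<gamma>\<close>.\<close>

definition countable_skeleton :: "'d set \<Rightarrow> 'd rel \<Rightarrow> ('d \<Rightarrow> enat) \<Rightarrow> bool" where
  "countable_skeleton \<Delta> r N \<longleftrightarrow>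
     \<Delta> \<noteq> {} \<and> countable \<Delta> \<and> partial_order_on \<Delta> r \<and> (\<forall>\<delta>\<in>\<Delta>. N \<delta> \<noteq> 0)"

definition maximal_skeleton :: "'d set \<Rightarrow> ('d \<Rightarrow> enat) \<Rightarrow> bool" where
  "maximal_skeleton \<Delta> N \<longleftrightarrow> (\<forall>\<delta>\<in>\<Delta>. N \<delta> = \<infinity>)"

definition quasi_maximal_skeleton :: "'d set \<Rightarrow> ('d \<Rightarrow> enat) \<Rightarrow> bool" where
  "quasi_maximal_skeleton \<Delta> N \<longleftrightarrow> (\<forall>\<delta>\<in>\<Delta>. N \<delta> \<in> {1, \<infinity>})"

definition up_set :: "'d set \<Rightarrow> 'd rel \<Rightarrow> 'd \<Rightarrow> 'd set" where
  "up_set \<Delta> r \<delta> = {\<gamma> \<in> \<Delta>. (\<delta>, \<gamma>) \<in> r}"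

definition Fin :: "'d set \<Rightarrow> 'd set set" where
  "Fin \<Delta> = {A. A \<subseteq> \<Delta> \<and> finite A}"

definition LF :: "'d set \<Rightarrow> 'd rel \<Rightarrow> 'd set set" where
  "LF \<Delta> r = {A. A \<subseteq> \<Delta> \<and> (\<forall>\<delta>\<in>\<Delta>. finite (A \<inter> up_set \<Delta> r \<delta>))}"

definition supp :: "'d set \<Rightarrow> ('d \<Rightarrow> nat) \<Rightarrow> 'd set" where
  "supp \<Delta> x = {\<gamma> \<in> \<Delta>. x \<gamma> \<noteq> 0}"

definition support_prod :: "'d set set \<Rightarrow> 'd set \<Rightarrow> ('d \<Rightarrow> enat) \<Rightarrow> ('d \<Rightarrow> nat) set" where
  "support_prod \<A> \<Delta> N = {x \<in> (\<Pi>\<^sub>E \<delta>\<in>\<Delta>. {k. enat k < N \<delta>}). supp \<Delta> x \<in> \<A>}"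

definition Wr_set ::
    "'d set set \<Rightarrow> 'd set \<Rightarrow> 'd rel \<Rightarrow> ('d \<Rightarrow> enat) \<Rightarrow> (('d \<Rightarrow> nat) \<Rightarrow> ('d \<Rightarrow> nat)) set" where
  "Wr_set \<A> \<Delta> r N =
     {g \<in> Bij (support_prod \<A> \<Delta> N).
        \<forall>x\<in>support_prod \<A> \<Delta> N. \<forall>y\<in>support_prod \<A> \<Delta> N. \<forall>\<delta>\<in>\<Delta>.
          restrict x (up_set \<Delta> r \<delta>) = restrict y (up_set \<Delta> r \<delta>) \<longleftrightarrow>
          restrict (g x) (up_set \<Delta> r \<delta>) = restrict (g y) (up_set \<Delta> r \<delta>)}"

definition Wr_group ::
    "'d set set \<Rightarrow> 'd set \<Rightarrow> 'd rel \<Rightarrow> ('d \<Rightarrow> enat) \<Rightarrow> (('d \<Rightarrow> nat) \<Rightarrow> ('d \<Rightarrow> nat)) monoid" where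
  "Wr_group \<A> \<Delta> r N = (BijGroup (support_prod \<A> \<Delta> N))\<lparr>carrier := Wr_set \<A> \<Delta> r N\<rparr>"

definition support_prod_topology ::
    "'d set set \<Rightarrow> 'd set \<Rightarrow> 'd rel \<Rightarrow> ('d \<Rightarrow> enat) \<Rightarrow> ('d \<Rightarrow> nat) topology" where
  "support_prod_topology \<A> \<Delta> r N =
     topology_generated_by
       {{y \<in> support_prod \<A> \<Delta> N. restrict y (up_set \<Delta> r \<gamma>) = restrict x (up_set \<Delta> r \<gamma>)}
         | x \<gamma>. x \<in> support_prod \<A> \<Delta> N \<and> \<gamma> \<in> \<Delta>}"

definition Wr_topology ::
    "'d set set \<Rightarrow> 'd set \<Rightarrow> 'd rel \<Rightarrow> ('d \<Rightarrow> enat) \<Rightarrow> (('d \<Rightarrow> nat) \<Rightarrow> ('d \<Rightarrow> nat)) topology" where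
  "Wr_topology \<A> \<Delta> r N =
     pointwise_topology (support_prod_topology \<A> \<Delta> r N) (Wr_set \<A> \<Delta> r N)"

definition tau_star ::
    "'d set \<Rightarrow> 'd rel \<Rightarrow> ('d \<Rightarrow> enat) \<Rightarrow> (('d \<Rightarrow> nat) \<Rightarrow> ('d \<Rightarrow> nat)) topology" where
  "tau_star \<Delta> r N =
     pointwise_topology (discrete_topology (support_prod (Fin \<Delta>) \<Delta> N)) (Wr_set (Fin \<Delta>) \<Delta> r N)"

lemma topspace_support_prod_topology:
  assumes "countable_skeleton \<Delta> r N"
  shows "topspace (support_prod_topology \<A> \<Delta> r N) = support_prod \<A> \<Delta> N"
proof -
  obtain \<delta> where "\<delta> \<in> \<Delta>" using assms by (auto simp: countable_skeleton_def)
  then show ?thesis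
    unfolding support_prod_topology_def topology_generated_by_topspace by blast
qed

text \<open>Over a maximal skeleton both products are nontrivial (recall that a skeleton is nonempty),
  although the isometry group of a one-point space and the product over a skeleton with
  \<open>N = 1\<close> throughout are trivial. A characterization by maximal skeletons therefore has to list
  the trivial group (the product over the empty index set) separately.\<close>

lemma Wr_group_maximal_nontrivial:
  assumes sk: "countable_skeleton \<Delta> r N" and mx: "maximal_skeleton \<Delta> N"
    and \<A>: "\<A> = Fin \<Delta> \<or> \<A> = LF \<Delta> r"
  shows "carrier (Wr_group \<A> \<Delta> r N) \<noteq> {\<one>\<^bsub>Wr_group \<A> \<Delta> r N\<^esub>}"
proof -
  define S where "S = support_prod \<A> \<Delta> N"
  obtain \<delta> where \<delta>: "\<delta> \<in> \<Delta>"
    using sk by (auto simp: countable_skeleton_def)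
  define sw :: "nat \<Rightarrow> nat" where "sw = (\<lambda>n. if n = 0 then 1 else if n = 1 then 0 else n)"
  have sw_sw: "sw (sw n) = n" for n by (simp add: sw_def)
  define f :: "('a \<Rightarrow> nat) \<Rightarrow> ('a \<Rightarrow> nat)" where "f = (\<lambda>x. x(\<delta> := sw (x \<delta>)))"
  have f_f: "f (f x) = x" for x by (simp add: f_def sw_sw)
  have ins: "supp \<Delta> (f x) \<subseteq> insert \<delta> (supp \<Delta> x)" for x
    by (auto simp: supp_def f_def)
  have down: "B \<in> \<A>" if A: "A \<in> \<A>" and B: "B \<subseteq> insert \<delta> A" "B \<subseteq> \<Delta>" for A B
  proof -
    have "finite (B \<inter> X)" if "finite (A \<inter> X)" for X
      by (rule finite_subset[of _ "insert \<delta> (A \<inter> X)"]) (use that B in auto)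
    moreover have "finite B" if "finite A"
      by (rule finite_subset[of _ "insert \<delta> A"]) (use that B in auto)
    ultimately show ?thesis using \<A> A B by (auto simp: Fin_def LF_def)
  qed
  have fS: "f x \<in> S" if "x \<in> S" for x
  proof -
    have x: "x \<in> extensional \<Delta>" "supp \<Delta> x \<in> \<A>"
      using that by (auto simp: S_def support_prod_def PiE_def)
    have "f x \<in> extensional \<Delta>" using x \<delta> by (auto simp: f_def extensional_def)
    moreover have "supp \<Delta> (f x) \<in> \<A>"
      by (rule down[OF x(2) ins]) (auto simp: supp_def)
    ultimately show ?thesis
      using mx by (auto simp: S_def support_prod_def PiE_def maximal_skeleton_def)
  qed
  define g where "g = restrict f S"
  have "bij_betw f S S"
    by (rule bij_betw_byWitness[where f' = f]) (use f_f fS in auto)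
  then have gB: "g \<in> Bij S" by (auto simp: Bij_def g_def)
  have res: "restrict x A = restrict y A \<longleftrightarrow> (\<forall>i\<in>A. x i = y i)" for x y :: "'a \<Rightarrow> nat" and A
    unfolding fun_eq_iff restrict_def by auto
  have sw_inj: "sw m = sw n \<longleftrightarrow> m = n" for m n by (metis sw_sw)
  have "restrict (f x) A = restrict (f y) A \<longleftrightarrow> restrict x A = restrict y A" for x y A
    unfolding res by (auto simp: f_def sw_inj)
  then have "g \<in> Wr_set \<A> \<Delta> r N"
    using gB by (auto simp: Wr_set_def g_def S_def[symmetric])
  moreover have "g \<noteq> (\<lambda>x\<in>S. x)"
  proof -
    define z where "z = (\<lambda>i\<in>\<Delta>. 0::nat)"
    have "supp \<Delta> z = {}" by (auto simp: supp_def z_def)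
    then have "z \<in> S" using \<A> mx
      by (auto simp: S_def support_prod_def z_def Fin_def LF_def maximal_skeleton_def)
    moreover have "f z \<delta> \<noteq> z \<delta>" using \<delta> by (simp add: f_def sw_def z_def)
    ultimately show ?thesis
      unfolding g_def fun_eq_iff by (intro notI) (drule spec[of _ z], simp)
  qed
  ultimately show ?thesis by (auto simp: Wr_group_def BijGroup_def S_def)
qed

end

theory Submission
  imports Defs
begin

text \<open>Homogeneity and wideness together give the one-point extension property: to realise prescribed
  distances to a finite set, take the least of them, \<open>r\<close>, attained at \<open>a\<close>; among the infinitely many
  points of an \<open>r\<close>-equidistant set through \<open>a\<close> only finitely many can be too close to the other points.
  Back-and-forth and completeness then show that homogeneous wide Polish ultrametric spaces are
  Urysohn spaces and that the distance set determines them up to isometry.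

  On the other hand, a strictly increasing \<open>\<phi> : \<Delta> \<rightarrow> (0,\<infinity>)\<close> turns \<open>S\<close> into an ultrametric space by
  letting \<open>d x y\<close> be the largest \<open>\<phi> \<delta>\<close> with \<open>x \<delta> \<noteq> y \<delta>\<close>. Its isometry group is the wreath product, it is
  homogeneous and wide, and its distance set consists of the \<open>\<phi> \<delta>\<close> with \<open>N \<delta> = \<infinity>\<close>. For \<open>LF\<close> supports it is
  complete with the right topology if \<open>\<phi>\<close> takes arbitrarily small values or \<open>\<Delta>\<close> has a least element;
  for finite supports it is complete and discrete if \<open>\<phi>\<close> is bounded away from 0. A given distance set
  that is bounded away from 0 is fitted to \<open>LF\<close> by adding levels \<open>1/(n+1)\<close> with \<open>N = 1\<close>, and to \<open>\<tau>\<^sup>*\<close>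
  with no change.\<close>

section \<open>Polish ultrametric spaces\<close>

lemma mdist_self [simp]: "x \<in> mspace U \<Longrightarrow> mdist U x x = 0"
  by simp

lemma Polish_ultrametric_triangle:
  assumes "Polish_ultrametric U" "x \<in> mspace U" "y \<in> mspace U" "z \<in> mspace U"
  shows "mdist U x z \<le> max (mdist U x y) (mdist U y z)"
  using assms by (auto simp: Polish_ultrametric_def)

lemma separable_space_mtopology_of_iff:
  "separable_space (mtopology_of U) \<longleftrightarrow>
     (\<exists>C. countable C \<and> C \<subseteq> mspace U \<and> (\<forall>x\<in>mspace U. \<forall>e>0. \<exists>c\<in>C. mdist U x c < e))"
proof -
  interpret U: Metric_space "mspace U" "mdist U" by simp
  have cl: "U.mtopology closure_of C = mspace U \<longleftrightarrow> (\<forall>x\<in>mspace U. \<forall>e>0. \<exists>c\<in>C. mdist U x c < e)"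
    if "C \<subseteq> mspace U" for C
  proof -
    have *: "(\<exists>y\<in>C. y \<in> U.mball x e) \<longleftrightarrow> (\<exists>c\<in>C. mdist U x c < e)" if "x \<in> mspace U" for x e
      using that \<open>C \<subseteq> mspace U\<close> by (auto simp: U.in_mball)
    have "{x \<in> mspace U. P x} = mspace U \<longleftrightarrow> (\<forall>x\<in>mspace U. P x)" for P by blast
    then show ?thesis unfolding U.metric_closure_of by (simp add: * del: U.in_mball)
  qed
  show ?thesis
    unfolding separable_space_def mtopology_of_def U.topspace_mtopology
    by (rule ex_cong1) (simp add: cl cong: conj_cong)
qed

lemma mcomplete_of_iff:
  fixes U :: "'a metric"
  shows "mcomplete_of U \<longleftrightarrow>
     (\<forall>s :: nat \<Rightarrow> 'a. (\<forall>n. s n \<in> mspace U) \<and> (\<forall>e>0. \<exists>N. \<forall>m\<ge>N. \<forall>n\<ge>N. mdist U (s m) (s n) < e) \<longrightarrow>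
        (\<exists>x\<in>mspace U. \<forall>e>0. \<exists>N. \<forall>n\<ge>N. mdist U (s n) x < e))"
proof -
  interpret U: Metric_space "mspace U" "mdist U" by simp
  have 1: "U.MCauchy s \<longleftrightarrow>
      (\<forall>n. s n \<in> mspace U) \<and> (\<forall>e>0. \<exists>N. \<forall>m\<ge>N. \<forall>n\<ge>N. mdist U (s m) (s n) < e)" for s
    unfolding U.MCauchy_def image_subset_iff by (simp add: imp_conjL[symmetric] conj_commute) meson
  have 2: "limitin U.mtopology s x sequentially \<longleftrightarrow>
      x \<in> mspace U \<and> (\<forall>e>0. \<exists>N. \<forall>n\<ge>N. mdist U (s n) x < e)" if "\<forall>n. s n \<in> mspace U" for s x
    unfolding U.limit_metric_sequentially by (simp add: that)
  show ?thesis
    unfolding mcomplete_of_def U.mcomplete_def 1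
  proof (rule arg_cong[where f = All], rule ext, rule imp_cong, rule refl)
    fix s :: "nat \<Rightarrow> 'a"
    assume s: "(\<forall>n. s n \<in> mspace U) \<and> (\<forall>e>0. \<exists>N. \<forall>m\<ge>N. \<forall>n\<ge>N. mdist U (s m) (s n) < e)"
    show "(\<exists>x. limitin U.mtopology s x sequentially) \<longleftrightarrow>
        (\<exists>x\<in>mspace U. \<forall>e>0. \<exists>N. \<forall>n\<ge>N. mdist U (s n) x < e)"
      unfolding 2[OF conjunct1[OF s]] Bex_def ..
  qed
qed

lemma Polish_ultrametric_dense:
  assumes "Polish_ultrametric U"
  obtains C where "countable C" "C \<subseteq> mspace U"
    "\<And>x e. x \<in> mspace U \<Longrightarrow> e > 0 \<Longrightarrow> \<exists>c\<in>C. mdist U x c < e"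
proof -
  have "separable_space (mtopology_of U)" using assms by (simp add: Polish_ultrametric_def)
  then obtain C where "countable C" "C \<subseteq> mspace U" "\<forall>x\<in>mspace U. \<forall>e>0. \<exists>c\<in>C. mdist U x c < e"
    unfolding separable_space_mtopology_of_iff by auto
  then show ?thesis by (intro that[of C]) simp_all
qed

lemma Polish_ultrametric_limit:
  fixes s :: "nat \<Rightarrow> 'a"
  assumes "Polish_ultrametric U" "\<And>n. s n \<in> mspace U"
    "\<And>e. e > 0 \<Longrightarrow> \<exists>N. \<forall>m\<ge>N. \<forall>n\<ge>N. mdist U (s m) (s n) < e"
  obtains x where "x \<in> mspace U" "\<And>e. e > 0 \<Longrightarrow> \<exists>N. \<forall>n\<ge>N. mdist U (s n) x < e"
proof -
  have "mcomplete_of U" using assms(1) by (simp add: Polish_ultrametric_def)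
  then have "\<exists>x\<in>mspace U. \<forall>e>0. \<exists>N. \<forall>n\<ge>N. mdist U (s n) x < e"
    unfolding mcomplete_of_iff using assms(2,3) by simp
  then obtain x where "x \<in> mspace U" "\<forall>e>0. \<exists>N. \<forall>n\<ge>N. mdist U (s n) x < e" by auto
  then show ?thesis by (intro that[of x]) simp_all
qed

text \<open>Replacing \<open>x\<close> and \<open>y\<close> by points of a countable dense set that
  are closer to them than \<open>r = mdist U x y\<close> leaves the distance equal to
  \<open>r\<close>, by the strong triangle inequality. So every distance occurs already between
  points of the dense set.\<close>

lemma Polish_ultrametric_countable_distance_set:
  assumes U: "Polish_ultrametric U"
  shows "countable (distance_set U)"
proof -
  obtain C where C: "countable C" "C \<subseteq> mspace U"
    and dense: "\<And>x e. x \<in> mspace U \<Longrightarrow> e > 0 \<Longrightarrow> \<exists>c\<in>C. mdist U x c < e"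
    using Polish_ultrametric_dense[OF U] by blast
  have "distance_set U \<subseteq> (\<lambda>(c, c'). mdist U c c') ` (C \<times> C)"
  proof
    fix r assume "r \<in> distance_set U"
    then obtain x y where xy: "x \<in> mspace U" "y \<in> mspace U" "x \<noteq> y" "r = mdist U x y"
      by (auto simp: distance_set_def)
    then have r: "r > 0" by (metis mdist_nonneg mdist_zero less_eq_real_def)
    obtain c c' where c: "c \<in> C" "mdist U x c < r" "c' \<in> C" "mdist U y c' < r"
      using dense[OF xy(1) r] dense[OF xy(2) r] by auto
    have m: "c \<in> mspace U" "c' \<in> mspace U" using c C by auto
    have "mdist U x c' \<le> max r (mdist U y c')" "r \<le> max (mdist U x c') (mdist U c' y)"
      "mdist U c c' \<le> max (mdist U c x) (mdist U x c')" "mdist U x c' \<le> max (mdist U x c) (mdist U c c')"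
      unfolding xy(4) by (intro Polish_ultrametric_triangle[OF U] xy(1,2) m)+
    then have "mdist U c c' = r"
      using c mdist_commute[of U c x] mdist_commute[of U c' y] by (simp add: max_def split: if_splits)
    then show "r \<in> (\<lambda>(c, c'). mdist U c c') ` (C \<times> C)" using c(1,3) by (intro image_eqI[of _ _ "(c, c')"]) simp_all
  qed
  then show ?thesis by (rule countable_subset) (simp add: C(1))
qed

lemma distance_set_pos: "r \<in> distance_set U \<Longrightarrow> r > 0"
  unfolding distance_set_def using mdist_nonneg mdist_zero by (fastforce simp: less_eq_real_def)


section \<open>Extending isometric relations\<close>

text \<open>Partial isometries are kept as relations, so that extending the domain and extending the
  range are exchanged by taking converses. Equality of distances already makes such a relation
  single-valued and injective.\<close>

definition iso_rel :: "'a metric \<Rightarrow> 'b metric \<Rightarrow> ('a \<times> 'b) set \<Rightarrow> bool" where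
  "iso_rel U V R \<longleftrightarrow> R \<subseteq> mspace U \<times> mspace V \<and>
     (\<forall>a b a' b'. (a, b) \<in> R \<longrightarrow> (a', b') \<in> R \<longrightarrow> mdist U a a' = mdist V b b')"

lemma iso_relI:
  assumes "\<And>a b. (a, b) \<in> R \<Longrightarrow> a \<in> mspace U \<and> b \<in> mspace V"
    "\<And>a b a' b'. (a, b) \<in> R \<Longrightarrow> (a', b') \<in> R \<Longrightarrow> mdist U a a' = mdist V b b'"
  shows "iso_rel U V R"
  using assms unfolding iso_rel_def by auto

lemma iso_relD:
  assumes "iso_rel U V R" "(a, b) \<in> R"
  shows "a \<in> mspace U" "b \<in> mspace V"
  using assms unfolding iso_rel_def by auto

lemma iso_rel_mdist:
  "iso_rel U V R \<Longrightarrow> (a, b) \<in> R \<Longrightarrow> (a', b') \<in> R \<Longrightarrow> mdist U a a' = mdist V b b'"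
  unfolding iso_rel_def by simp

lemma iso_rel_converse: "iso_rel V U (R\<inverse>) \<longleftrightarrow> iso_rel U V R"
proof -
  have "iso_rel V U (R\<inverse>)" if "iso_rel U V R" for U :: "'c metric" and V :: "'d metric" and R
    by (rule iso_relI) (use iso_relD[OF that] iso_rel_mdist[OF that] in auto)
  from this[of U V R] this[of V U "R\<inverse>"] show ?thesis by auto
qed

lemma iso_rel_insert:
  assumes R: "iso_rel U V R" and xy: "x \<in> mspace U" "y \<in> mspace V"
    and d: "\<And>a b. (a, b) \<in> R \<Longrightarrow> mdist V y b = mdist U x a"
  shows "iso_rel U V (insert (x, y) R)"
proof -
  have 0: "mdist U x x = 0" "mdist V y y = 0" using xy by simp_all
  have d': "mdist V b y = mdist U a x" if "(a, b) \<in> R" for a b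
    using d[OF that] by (simp add: mdist_commute)
  show ?thesis
  proof (rule iso_relI)
    fix a b assume "(a, b) \<in> insert (x, y) R"
    then show "a \<in> mspace U \<and> b \<in> mspace V" using xy iso_relD[OF R] by auto
    fix a' b' assume "(a', b') \<in> insert (x, y) R"
    with \<open>(a, b) \<in> insert (x, y) R\<close> show "mdist U a a' = mdist V b b'"
      using 0 d d' iso_rel_mdist[OF R] by auto
  qed
qed

section \<open>The one-point extension property and back-and-forth\<close>

lemma homogeneous_wide_extend:
  assumes U: "Polish_ultrametric U" and V: "Polish_ultrametric V" "homogeneous V" "wide V"
    and ne: "mspace V \<noteq> {}" and D: "distance_set U \<subseteq> distance_set V"
    and p: "finite p" "iso_rel U V p" and x: "x \<in> mspace U"
  shows "\<exists>y. iso_rel U V (insert (x, y) p)"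
proof (cases "p = {}")
  case True
  obtain y where "y \<in> mspace V" using ne by blast
  then have "iso_rel U V (insert (x, y) p)"
    using True p x by (intro iso_rel_insert) auto
  then show ?thesis ..
next
  case False
  have pm: "a \<in> mspace U" "b \<in> mspace V" if "(a, b) \<in> p" for a b
    using that p(2) by (auto simp: iso_rel_def)
  have pd: "mdist U a a' = mdist V b b'" if "(a, b) \<in> p" "(a', b') \<in> p" for a b a' b'
    using that p(2) by (auto simp: iso_rel_def)
  \<comment> \<open>\<open>q\<close> is the finite set of distances from \<open>x\<close> to the
    points of the domain. A nearest such point \<open>a0\<close>, matched with \<open>b0\<close>,
    guides the choice of \<open>y\<close>.\<close>
  define q where "q = (\<lambda>(a, b). mdist U x a) ` p"
  have q: "finite q" "q \<noteq> {}" using p(1) False by (auto simp: q_def)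
  define r where "r = Min q"
  have "r \<in> q" using q by (simp add: r_def)
  then obtain a0 b0 where 0: "(a0, b0) \<in> p" "mdist U x a0 = r" by (auto simp: q_def)
  have rmin: "r \<le> mdist U x a" if "(a, b) \<in> p" for a b
    unfolding r_def using q(1) that by (intro Min_le) (auto simp: q_def)
  \<comment> \<open>If \<open>x = a0\<close>, then \<open>b0\<close> serves as the partner.
    Otherwise \<open>r\<close> is a genuine distance, and wideness of \<open>V\<close> applies to
    it.\<close>
  show ?thesis
  proof (cases "x = a0")
    case True
    then show ?thesis using 0 p(2) by (intro exI[of _ b0]) (simp add: insert_absorb)
  next
    case neq: False
    have "r \<in> distance_set U" using 0 pm x neq unfolding distance_set_def by blast
    then have "r \<in> distance_set V" using D by blast
    then have rpos: "r > 0" by (rule distance_set_pos)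
    obtain A where A: "A \<subseteq> mspace V" "infinite A" "\<And>u v. u \<in> A \<Longrightarrow> v \<in> A \<Longrightarrow> u \<noteq> v \<Longrightarrow> mdist V u v = r"
      using V(3) \<open>r \<in> distance_set V\<close> unfolding wide_def by meson
    obtain e where e: "e \<in> A" using A(2) by (metis ex_in_conv finite.emptyI)
    \<comment> \<open>Homogeneity moves the equidistant set so that it passes through
      \<open>b0\<close>.\<close>
    obtain g where g: "g \<in> isometries V" "g e = b0"
      using V(2) e A(1) 0 pm unfolding homogeneous_def by blast
    have gb: "bij_betw g (mspace V) (mspace V)" using g by (auto simp: isometries_def Bij_def)
    define E where "E = g ` A"
    have "inj_on g A" using gb A(1) by (meson bij_betw_def inj_on_subset)
    then have "infinite E" using A(2) by (simp add: E_def finite_image_iff)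
    have EV: "E \<subseteq> mspace V" using gb A(1) by (auto simp: E_def bij_betw_def)
    have Er: "mdist V u v = r" if uv: "u \<in> E" "v \<in> E" "u \<noteq> v" for u v
    proof -
      obtain u' v' where "u' \<in> A" "v' \<in> A" "u = g u'" "v = g v'" using uv by (auto simp: E_def)
      moreover have "mdist V (g u') (g v') = mdist V u' v'"
        using g(1) A(1) calculation by (auto simp: isometries_def preserves_dist_def)
      ultimately show ?thesis using A(3) uv(3) by auto
    qed
    have bE: "b0 \<in> E" using e g by (auto simp: E_def)
    \<comment> \<open>Two points of \<open>E\<close> closer than \<open>r\<close> to
      \<open>b\<close> would be closer than \<open>r\<close> to each other, so this set has at most
      one element.\<close>
    have fin1: "finite {z \<in> E. mdist V z b < r}" if b: "b \<in> mspace V" for b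
    proof (rule ccontr)
      assume inf: "\<not> ?thesis"
      then obtain u where u: "u \<in> E" "mdist V u b < r"
        using infinite_imp_nonempty by blast
      have "infinite ({z \<in> E. mdist V z b < r} - {u})" using inf by simp
      then obtain v where v: "v \<in> E" "mdist V v b < r" "v \<noteq> u"
        using infinite_imp_nonempty by blast
      have "mdist V u v \<le> max (mdist V u b) (mdist V b v)"
        using u(1) v(1) b EV by (intro Polish_ultrametric_triangle[OF V(1)]) auto
      then show False using Er[OF u(1) v(1)] u v by (simp add: mdist_commute)
    qed
    have "finite (\<Union>b\<in>snd ` p. {z \<in> E. mdist V z b < r})"
      using p(1) fin1 pm by auto
    then obtain y where y: "y \<in> E" and y2: "\<And>a b. (a, b) \<in> p \<Longrightarrow> \<not> mdist V y b < r"

    proof -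
      assume "finite (\<Union>b\<in>snd ` p. {z \<in> E. mdist V z b < r})"
      from infinite_imp_nonempty[OF Diff_infinite_finite[OF this \<open>infinite E\<close>]]
      obtain y where "y \<in> E" "y \<notin> (\<Union>b\<in>snd ` p. {z \<in> E. mdist V z b < r})" by auto
      then show thesis by (intro that[of y]) force+
    qed
    have yV: "y \<in> mspace V" using y EV by blast
    have yb0: "mdist V y b0 = r"
      using Er[OF y bE] y2[OF 0(1)] rpos yV by (cases "y = b0") auto
    \<comment> \<open>Both distances are the maximum of \<open>r\<close> and the common value
      \<open>mdist U a a0 = mdist V b b0\<close>: each is at least \<open>r\<close>, and the strong
      triangle inequality leaves no other possibility.\<close>
    have "mdist V y b = mdist U x a" if ab: "(a, b) \<in> p" for a b
    proof -
      have m: "a \<in> mspace U" "b \<in> mspace V" "a0 \<in> mspace U" "b0 \<in> mspace V" using pm ab 0 by auto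
      have "mdist U a a0 = mdist V b b0" using pd ab 0 by blast
      moreover have "mdist U a a0 \<le> max (mdist U a x) (mdist U x a0)"
         "mdist U x a \<le> max (mdist U x a0) (mdist U a0 a)"
        by (intro Polish_ultrametric_triangle[OF U] m x)+
      moreover have "mdist V y b \<le> max (mdist V y b0) (mdist V b0 b)"
         "mdist V b0 b \<le> max (mdist V b0 y) (mdist V y b)"
        by (intro Polish_ultrametric_triangle[OF V(1)] m yV)+
      ultimately show ?thesis
        using rmin[OF ab] y2[OF ab] 0(2) yb0
          mdist_commute[of U a x] mdist_commute[of U a a0] mdist_commute[of V b b0] mdist_commute[of V y b0]
        by (simp add: max_def split: if_splits)
    qed
    then show ?thesis using iso_rel_insert[OF p(2) x yV] by blast
  qed
qed

text \<open>Stage \<open>n\<close> puts the points numbered \<open>n\<close> of \<open>C\<close> and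
  of \<open>E\<close> into the domain and the range. Each stage is finite, and the union of the
  increasing chain is the relation sought.\<close>

lemma back_and_forth:
  assumes C: "countable C" and E: "countable E"
    and forward: "\<And>p x. finite p \<Longrightarrow> iso_rel U V p \<Longrightarrow> x \<in> C \<Longrightarrow> \<exists>y. iso_rel U V (insert (x, y) p)"
    and backward: "\<And>p y. finite p \<Longrightarrow> iso_rel U V p \<Longrightarrow> y \<in> E \<Longrightarrow> \<exists>x. iso_rel U V (insert (x, y) p)"
    and p: "finite p" "iso_rel U V p"
  obtains R where "p \<subseteq> R" "iso_rel U V R" "C \<subseteq> Domain R" "E \<subseteq> Range R"
proof -
  define ok where "ok n q \<longleftrightarrow> (\<forall>x\<in>C. to_nat_on C x = n \<longrightarrow> x \<in> Domain q) \<and>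
      (\<forall>y\<in>E. to_nat_on E y = n \<longrightarrow> y \<in> Range q)" for n and q :: "('a \<times> 'b) set"
  have step: "\<exists>q'. (finite q' \<and> iso_rel U V q') \<and> q \<subseteq> q' \<and> ok n q'"
    if q: "finite q \<and> iso_rel U V q" for q n
  proof -
    obtain q1 where q1: "finite q1" "iso_rel U V q1" "q \<subseteq> q1" "\<forall>x\<in>C. to_nat_on C x = n \<longrightarrow> x \<in> Domain q1"
    proof (cases "\<exists>x\<in>C. to_nat_on C x = n")
      case True
      then obtain x where x: "x \<in> C" "to_nat_on C x = n" by blast
      have "x' = x" if "x' \<in> C" "to_nat_on C x' = n" for x'
        using that x inj_on_to_nat_on[OF C] by (auto dest: inj_onD)
      moreover obtain y where "iso_rel U V (insert (x, y) q)" using forward q x by blast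
      ultimately show ?thesis using that[of "insert (x, y) q"] q by auto
    next
      case False
      then show ?thesis using that[of q] q by auto
    qed
    obtain q2 where q2: "finite q2" "iso_rel U V q2" "q1 \<subseteq> q2" "\<forall>y\<in>E. to_nat_on E y = n \<longrightarrow> y \<in> Range q2"
    proof (cases "\<exists>y\<in>E. to_nat_on E y = n")
      case True
      then obtain y where y: "y \<in> E" "to_nat_on E y = n" by blast
      have "y' = y" if "y' \<in> E" "to_nat_on E y' = n" for y'
        using that y inj_on_to_nat_on[OF E] by (auto dest: inj_onD)
      moreover obtain x where "iso_rel U V (insert (x, y) q1)" using backward q1 y by blast
      ultimately show ?thesis using that[of "insert (x, y) q1"] q1 by auto
    next
      case False
      then show ?thesis using that[of q1] q1 by auto
    qed
    have "ok n q2" using q1(3,4) q2(3,4) unfolding ok_def by blast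
    then show ?thesis using q1(3) q2(1-3) by (intro exI[of _ q2]) auto
  qed
  obtain f where f: "\<And>n. finite (f n) \<and> iso_rel U V (f n)" "\<And>n. f n \<subseteq> f (Suc n) \<and> ok n (f (Suc n))"
      and f0: "f 0 = p"
  proof -
    \<comment> \<open>The extra condition at \<open>n = 0\<close> pins the first member of the chain
      to \<open>p\<close>.\<close>
    have "\<exists>f. \<forall>n. ((finite (f n) \<and> iso_rel U V (f n)) \<and> (n = 0 \<longrightarrow> f n = p)) \<and> f n \<subseteq> f (Suc n) \<and> ok n (f (Suc n))"
      by (rule dependent_nat_choice) (use p step in auto)
    then show ?thesis using that by blast
  qed
  have mono: "f m \<subseteq> f n" if "m \<le> n" for m n
    using that f(2) by (rule_tac lift_Suc_mono_le[of f]) simp_all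
  define R where "R = (\<Union>n. f n)"
  have "iso_rel U V R"
    unfolding iso_rel_def
  proof (intro conjI allI impI)
    show "R \<subseteq> mspace U \<times> mspace V" using f(1) unfolding R_def iso_rel_def by auto
    fix a b a' b' assume "(a, b) \<in> R" "(a', b') \<in> R"
    then obtain m n where "(a, b) \<in> f m" "(a', b') \<in> f n" by (auto simp: R_def)
    then have "(a, b) \<in> f (max m n)" "(a', b') \<in> f (max m n)"
      using mono[of m "max m n"] mono[of n "max m n"] by auto
    then show "mdist U a a' = mdist V b b'" by (rule iso_rel_mdist[OF conjunct2[OF f(1)]])
  qed
  moreover have "C \<subseteq> Domain R"
  proof
    fix x assume "x \<in> C"
    then have "x \<in> Domain (f (Suc (to_nat_on C x)))" using f(2)[of "to_nat_on C x"] unfolding ok_def by simp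
    then show "x \<in> Domain R" unfolding R_def by auto
  qed
  moreover have "E \<subseteq> Range R"
  proof
    fix y assume "y \<in> E"
    then have "y \<in> Range (f (Suc (to_nat_on E y)))" using f(2)[of "to_nat_on E y"] unfolding ok_def by simp
    then show "y \<in> Range R" unfolding R_def by auto
  qed
  moreover have "p \<subseteq> R" using f0 by (auto simp: R_def)
  ultimately show ?thesis using that by blast
qed

section \<open>Closures of isometric relations in the product of the two spaces\<close>

definition iso_rel_closure :: "'a metric \<Rightarrow> 'b metric \<Rightarrow> ('a \<times> 'b) set \<Rightarrow> ('a \<times> 'b) set" where
  "iso_rel_closure U V R = {(x, y) \<in> mspace U \<times> mspace V.
     \<forall>e>0. \<exists>a b. (a, b) \<in> R \<and> mdist U x a < e \<and> mdist V y b < e}"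

lemma iso_rel_closure_converse: "iso_rel_closure V U (R\<inverse>) = (iso_rel_closure U V R)\<inverse>"
  unfolding iso_rel_closure_def by blast

lemma iso_rel_subset_closure: "iso_rel U V R \<Longrightarrow> R \<subseteq> iso_rel_closure U V R"
proof
  fix z assume R: "iso_rel U V R" and z: "z \<in> R"
  obtain x y where xy: "z = (x, y)" by (cases z)
  with R z have "x \<in> mspace U" "y \<in> mspace V" by (auto simp: iso_rel_def)
  moreover from this have 0: "mdist U x x = 0" "mdist V y y = 0" by simp_all
  ultimately show "z \<in> iso_rel_closure U V R"
    using z unfolding iso_rel_closure_def xy by (auto simp del: mdist_zero intro!: exI[of _ x] exI[of _ y])
qed

text \<open>Approximating both ends of a distance within \<open>e/4\<close> changes it by less than
  \<open>e/2\<close>. On the approximants in \<open>R\<close> the two distances agree, so the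
  distances in question differ by less than any positive \<open>e\<close>.\<close>

lemma iso_rel_closure:
  assumes R: "iso_rel U V R"
  shows "iso_rel U V (iso_rel_closure U V R)"
  unfolding iso_rel_def
proof (intro conjI allI impI)
  show "iso_rel_closure U V R \<subseteq> mspace U \<times> mspace V" by (auto simp: iso_rel_closure_def)
  fix x y x' y' assume xy: "(x, y) \<in> iso_rel_closure U V R" "(x', y') \<in> iso_rel_closure U V R"
  then have m: "x \<in> mspace U" "x' \<in> mspace U" "y \<in> mspace V" "y' \<in> mspace V"
    by (auto simp: iso_rel_closure_def)
  have "\<bar>mdist U x x' - mdist V y y'\<bar> \<le> 0 + e" if e: "e > 0" for e
  proof -
    have "e/4 > 0" using e by simp
    then obtain a b a' b' where ab: "(a, b) \<in> R" "(a', b') \<in> R"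
      "mdist U x a < e/4" "mdist V y b < e/4" "mdist U x' a' < e/4" "mdist V y' b' < e/4"
      using xy unfolding iso_rel_closure_def by fast
    have m': "a \<in> mspace U" "a' \<in> mspace U" "b \<in> mspace V" "b' \<in> mspace V"
      and eq: "mdist U a a' = mdist V b b'"
      using ab R by (auto simp: iso_rel_def)
    have "mdist U x x' \<le> mdist U x a + mdist U a x'" "mdist U a x' \<le> mdist U a a' + mdist U a' x'"
      "mdist U a a' \<le> mdist U a x + mdist U x a'" "mdist U x a' \<le> mdist U x x' + mdist U x' a'"
      "mdist V y y' \<le> mdist V y b + mdist V b y'" "mdist V b y' \<le> mdist V b b' + mdist V b' y'"
      "mdist V b b' \<le> mdist V b y + mdist V y b'" "mdist V y b' \<le> mdist V y y' + mdist V y' b'"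
      by (intro mdist_triangle m m')+
    then show ?thesis
      using ab eq mdist_commute[of U x a] mdist_commute[of U x' a'] mdist_commute[of V y b] mdist_commute[of V y' b']
      by linarith
  qed
  then have "\<bar>mdist U x x' - mdist V y y'\<bar> \<le> 0" by (rule field_le_epsilon)
  then show "mdist U x x' = mdist V y y'" by simp
qed

text \<open>Points \<open>a n\<close> of the domain tending to \<open>x\<close> have partners
  \<open>b n\<close> that form a Cauchy sequence, because \<open>R\<close> preserves distances. By
  completeness of \<open>V\<close> they have a limit, and it is a partner of \<open>x\<close> in the
  closure.\<close>

lemma Domain_iso_rel_closure:
  assumes V: "Polish_ultrametric V" and R: "iso_rel U V R"
    and dense: "\<And>x e. x \<in> mspace U \<Longrightarrow> e > 0 \<Longrightarrow> \<exists>a\<in>Domain R. mdist U x a < e"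
    and x: "x \<in> mspace U"
  shows "x \<in> Domain (iso_rel_closure U V R)"
proof -
  have "\<exists>a b. (a, b) \<in> R \<and> mdist U x a < inverse (real (Suc n))" for n
    using dense[OF x, of "inverse (real (Suc n))"] by auto
  then obtain a b where ab: "\<And>n. (a n, b n) \<in> R" "\<And>n. mdist U x (a n) < inverse (real (Suc n))"
    by metis
  have m: "a n \<in> mspace U" "b n \<in> mspace V" for n using ab(1)[of n] R by (auto simp: iso_rel_def)
  have small: "\<exists>N. \<forall>n\<ge>N. mdist U x (a n) < e" if e: "e > 0" for e
  proof -
    obtain N where N: "inverse (real (Suc N)) < e" using reals_Archimedean[OF e] by blast
    have "mdist U x (a n) < e" if "n \<ge> N" for n
    proof -
      have "inverse (real (Suc n)) \<le> inverse (real (Suc N))" using that by simp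
      then show ?thesis using ab(2)[of n] N by linarith
    qed
    then show ?thesis by blast
  qed
  have "\<exists>N. \<forall>i\<ge>N. \<forall>j\<ge>N. mdist V (b i) (b j) < e" if e: "e > 0" for e
  proof -
    obtain N where N: "\<And>n. n \<ge> N \<Longrightarrow> mdist U x (a n) < e/2" using small[of "e/2"] e by auto
    have "mdist V (b i) (b j) < e" if "i \<ge> N" "j \<ge> N" for i j
    proof -
      have "mdist V (b i) (b j) = mdist U (a i) (a j)" using ab(1) R by (metis iso_rel_def)
      also have "\<dots> \<le> mdist U (a i) x + mdist U x (a j)" by (intro mdist_triangle m x)
      also have "\<dots> < e" using N[OF that(1)] N[OF that(2)] by (simp add: mdist_commute)
      finally show ?thesis .
    qed
    then show ?thesis by blast
  qed
  then obtain y where y: "y \<in> mspace V" "\<And>e. e > 0 \<Longrightarrow> \<exists>N. \<forall>n\<ge>N. mdist V (b n) y < e"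
    using Polish_ultrametric_limit[OF V, of b, OF m(2)] by metis
  have "\<exists>a b. (a, b) \<in> R \<and> mdist U x a < e \<and> mdist V y b < e" if e: "e > 0" for e
  proof -
    obtain N1 N2 where "\<forall>n\<ge>N1. mdist U x (a n) < e" "\<forall>n\<ge>N2. mdist V (b n) y < e"
      using small[OF e] y(2)[OF e] by auto
    then have "mdist U x (a (max N1 N2)) < e" "mdist V y (b (max N1 N2)) < e"
      by (auto simp: mdist_commute)
    then show ?thesis using ab(1) by blast
  qed
  then have "(x, y) \<in> iso_rel_closure U V R" using x y by (auto simp: iso_rel_closure_def)
  then show ?thesis by blast
qed

text \<open>Two partners of the same point are at distance \<open>mdist U x x\<close>, which is 0.
  The last conjunct retains the values prescribed by the relation.\<close>

lemma iso_rel_function: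
  assumes R: "iso_rel U V R" and dom: "mspace U \<subseteq> Domain R"
  shows "\<exists>f. f \<in> mspace U \<rightarrow> mspace V \<and> preserves_dist U V (mspace U) f \<and> (\<forall>x y. (x, y) \<in> R \<longrightarrow> f x = y)"
proof -
  have m: "x \<in> mspace U" "y \<in> mspace V" if "(x, y) \<in> R" for x y using that R by (auto simp: iso_rel_def)
  have uniq: "y = y'" if "(x, y) \<in> R" "(x, y') \<in> R" for x y y'
  proof -
    have "mdist U x x = mdist V y y'" using that by (rule iso_rel_mdist[OF R])
    then show ?thesis using m that by simp
  qed
  define f where "f x = (THE y. (x, y) \<in> R)" for x
  have f: "f x = y" if "(x, y) \<in> R" for x y
    unfolding f_def using that uniq by blast
  have fR: "(x, f x) \<in> R" if "x \<in> mspace U" for x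
    using that dom f by blast
  then have "f \<in> mspace U \<rightarrow> mspace V" using m by blast
  moreover have "preserves_dist U V (mspace U) f"
    unfolding preserves_dist_def using iso_rel_mdist[OF R fR fR] by simp
  ultimately show ?thesis using f by auto
qed

section \<open>Universality and uniqueness of homogeneous wide spaces\<close>

lemma homogeneous_wide_universal:
  assumes X: "Polish_ultrametric X" and V: "Polish_ultrametric V" "homogeneous V" "wide V"
    and ne: "mspace V \<noteq> {}" and D: "distance_set X \<subseteq> distance_set V"
  shows "\<exists>f \<in> mspace X \<rightarrow> mspace V. preserves_dist X V (mspace X) f"
proof -
  obtain C where C: "countable C" "C \<subseteq> mspace X"
    and dense: "\<And>x e. x \<in> mspace X \<Longrightarrow> e > 0 \<Longrightarrow> \<exists>c\<in>C. mdist X x c < e"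
    using Polish_ultrametric_dense[OF X] by blast
  have "\<exists>y. iso_rel X V (insert (x, y) p)" if "finite p" "iso_rel X V p" "x \<in> C" for p x
    using homogeneous_wide_extend[OF X V ne D that(1,2)] C that by blast
  moreover have "iso_rel X V {}" by (simp add: iso_rel_def)
  \<comment> \<open>Here only the forward half of back-and-forth takes place: the set to be put into
    the range is empty.\<close>
  ultimately obtain R where R: "iso_rel X V R" "C \<subseteq> Domain R"
    by (rule_tac back_and_forth[OF C(1), of "{}" X V "{}"]) auto
  have "mspace X \<subseteq> Domain (iso_rel_closure X V R)"
    using Domain_iso_rel_closure[OF V(1) R(1)] dense R(2) by blast
  then show ?thesis
    using iso_rel_function[OF iso_rel_closure[OF R(1)]] by auto
qed

text \<open>Carrying the inverse along makes the notion symmetric, so that each result on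
  \<open>F\<close> applies to \<open>F'\<close> as well. The values of both maps outside the spaces
  are left free.\<close>

definition isometry_pair :: "'a metric \<Rightarrow> 'b metric \<Rightarrow> ('a \<Rightarrow> 'b) \<Rightarrow> ('b \<Rightarrow> 'a) \<Rightarrow> bool" where
  "isometry_pair U V F F' \<longleftrightarrow> F \<in> mspace U \<rightarrow> mspace V \<and> F' \<in> mspace V \<rightarrow> mspace U \<and>
     (\<forall>x\<in>mspace U. F' (F x) = x) \<and> (\<forall>y\<in>mspace V. F (F' y) = y) \<and>
     preserves_dist U V (mspace U) F \<and> preserves_dist V U (mspace V) F'"

lemma isometry_pair_sym: "isometry_pair U V F F' \<Longrightarrow> isometry_pair V U F' F"
  by (auto simp: isometry_pair_def)

text \<open>Back-and-forth between countable dense sets gives a relation whose closure has full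
  domain and full range. A finite \<open>p\<close> is prescribed with a view to
  ultrahomogeneity.\<close>

lemma homogeneous_wide_isometric:
  assumes U: "Polish_ultrametric U" "homogeneous U" "wide U" "mspace U \<noteq> {}"
    and V: "Polish_ultrametric V" "homogeneous V" "wide V" "mspace V \<noteq> {}"
    and D: "distance_set U = distance_set V" and p: "finite p" "iso_rel U V p"
  obtains F F' where "isometry_pair U V F F'" "\<And>x y. (x, y) \<in> p \<Longrightarrow> F x = y"
proof -
  obtain C where C: "countable C" "C \<subseteq> mspace U"
    and denseC: "\<And>x e. x \<in> mspace U \<Longrightarrow> e > 0 \<Longrightarrow> \<exists>c\<in>C. mdist U x c < e"
    using Polish_ultrametric_dense[OF U(1)] by blast
  obtain E where E: "countable E" "E \<subseteq> mspace V"
    and denseE: "\<And>x e. x \<in> mspace V \<Longrightarrow> e > 0 \<Longrightarrow> \<exists>c\<in>E. mdist V x c < e"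
    using Polish_ultrametric_dense[OF V(1)] by blast
  have 1: "\<exists>y. iso_rel U V (insert (x, y) p)" if "finite p" "iso_rel U V p" "x \<in> C" for p x
    using homogeneous_wide_extend[OF U(1) V _ that(1,2)] D C that by blast
  have 2: "\<exists>x. iso_rel U V (insert (x, y) p)" if "finite p" "iso_rel U V p" "y \<in> E" for p y
  proof -
    have "\<exists>x. iso_rel V U (insert (y, x) (p\<inverse>))"
      using homogeneous_wide_extend[OF V(1) U, of "p\<inverse>" y] D E that by (auto simp: iso_rel_converse)
    moreover have "insert (y, x) (p\<inverse>) = (insert (x, y) p)\<inverse>" for x by auto
    ultimately show ?thesis by (simp add: iso_rel_converse)
  qed
  obtain R where R: "p \<subseteq> R" "iso_rel U V R" "C \<subseteq> Domain R" "E \<subseteq> Range R"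
    using back_and_forth[OF C(1) E(1) 1 2 p] by blast
  define Q where "Q = iso_rel_closure U V R"
  have Q: "iso_rel U V Q" "iso_rel V U (Q\<inverse>)" "p \<subseteq> Q"
    using R iso_rel_closure[OF R(2)] iso_rel_subset_closure[OF R(2)] by (auto simp: Q_def iso_rel_converse)
  have domU: "mspace U \<subseteq> Domain Q"
    unfolding Q_def using Domain_iso_rel_closure[OF V(1) R(2)] denseC R(3) by blast
  \<comment> \<open>The converse of the closure is the closure of the converse, so fullness of the
    range is fullness of the domain with the two spaces exchanged.\<close>
  have "iso_rel V U (R\<inverse>)" using R(2) by (simp add: iso_rel_converse)
  then have domV: "mspace V \<subseteq> Domain (Q\<inverse>)"
    unfolding Q_def iso_rel_closure_converse[symmetric]
    using Domain_iso_rel_closure[OF U(1) _ _, of V "R\<inverse>"] denseE R(4) by (simp add: subset_iff) blast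
  obtain F where F: "F \<in> mspace U \<rightarrow> mspace V" "preserves_dist U V (mspace U) F"
    "\<forall>x y. (x, y) \<in> Q \<longrightarrow> F x = y" using iso_rel_function[OF Q(1) domU] by auto
  obtain F' where F': "F' \<in> mspace V \<rightarrow> mspace U" "preserves_dist V U (mspace V) F'"
    "\<forall>y x. (y, x) \<in> Q\<inverse> \<longrightarrow> F' y = x" using iso_rel_function[OF Q(2) domV] by blast
  have "F' (F x) = x" if "x \<in> mspace U" for x
    using that domU F(3) F'(3) by fastforce
  moreover have "F (F' y) = y" if "y \<in> mspace V" for y
    using that domV F(3) F'(3) by fastforce
  ultimately have "isometry_pair U V F F'" using F F' by (simp add: isometry_pair_def)
  moreover have "F x = y" if "(x, y) \<in> p" for x y using that F(3) Q(3) by auto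
  ultimately show ?thesis by (rule that)
qed

lemma isometry_pair_isometries:
  assumes "isometry_pair U U F F'"
  shows "restrict F (mspace U) \<in> isometries U"
proof -
  have "bij_betw F (mspace U) (mspace U)"
    by (rule bij_betw_byWitness[where f' = F']) (use assms in \<open>auto simp: isometry_pair_def\<close>)
  then have "restrict F (mspace U) \<in> Bij (mspace U)"
    by (auto simp: Bij_def)
  then show ?thesis
    using assms by (auto simp: isometries_def isometry_pair_def preserves_dist_def)
qed

lemma homogeneous_wide_Urysohn:
  assumes U: "Polish_ultrametric U" "homogeneous U" "wide U" "mspace U \<noteq> {}"
  shows "Urysohn U"
  unfolding Urysohn_def
proof (intro conjI allI impI)
  show "Polish_ultrametric U" by (fact U)
  show "\<exists>f\<in>mspace X \<rightarrow> mspace U. preserves_dist X U (mspace X) f"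
    if "Polish_ultrametric X \<and> distance_set X \<subseteq> distance_set U" for X :: "(nat \<Rightarrow> nat) metric"
    using homogeneous_wide_universal[OF _ U] that by blast
  show "ultrahomogeneous U"
    unfolding ultrahomogeneous_def
  proof (intro allI impI)
    fix A B f
    assume A: "finite A \<and> A \<subseteq> mspace U \<and> finite B \<and> B \<subseteq> mspace U \<and> f ` A = B \<and> preserves_dist U U A f"
    \<comment> \<open>The finite map is turned into a relation. The uniqueness result, applied with
      both spaces equal to \<open>U\<close>, then extends it to an isometry of
      \<open>U\<close>.\<close>
    define p where "p = (\<lambda>x. (x, f x)) ` A"
    have p: "finite p" "iso_rel U U p"
      using A by (auto simp: p_def iso_rel_def preserves_dist_def)
    obtain F F' where F: "isometry_pair U U F F'" "\<And>x y. (x, y) \<in> p \<Longrightarrow> F x = y"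
      using homogeneous_wide_isometric[OF U U refl p] by blast
    show "\<exists>g\<in>isometries U. \<forall>x\<in>A. g x = f x"
      using isometry_pair_isometries[OF F(1)] F(2) A by (intro bexI) (auto simp: p_def)
  qed
qed


section \<open>Isomorphisms of isometry groups\<close>

lemma top_group_isomorphic_trans:
  assumes "top_group_isomorphic G T H T'" "top_group_isomorphic H T' K T''"
  shows "top_group_isomorphic G T K T''"
  using assms unfolding top_group_isomorphic_def
  using iso_set_trans homeomorphic_map_compose by blast

lemma carrier_Iso_group [simp]: "carrier (Iso_group U) = isometries U"
  by (simp add: Iso_group_def)

lemma mult_Iso_group:
  "f \<in> isometries U \<Longrightarrow> g \<in> isometries U \<Longrightarrow> f \<otimes>\<^bsub>Iso_group U\<^esub> g = compose (mspace U) f g"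
  by (simp add: Iso_group_def BijGroup_def isometries_def)

lemma isometries_subset: "isometries U \<subseteq> mspace U \<rightarrow>\<^sub>E mspace U"
  by (auto simp: isometries_def Bij_def PiE_def bij_betw_def)

lemma topspace_Iso_topology [simp]: "topspace (Iso_topology U) = isometries U"
  using isometries_subset[of U] by (auto simp: Iso_topology_def pointwise_topology_def)

lemma conj_isometry:
  assumes F: "isometry_pair U V F F'" and g: "g \<in> isometries U"
  shows "(\<lambda>v\<in>mspace V. F (g (F' v))) \<in> isometries V"
proof -
  have g': "bij_betw g (mspace U) (mspace U)" "preserves_dist U U (mspace U) g"
    using g by (auto simp: isometries_def Bij_def)
  have gm: "g x \<in> mspace U" if "x \<in> mspace U" for x using g'(1) that by (rule bij_betwE[rule_format])
  have bF: "bij_betw F (mspace U) (mspace V)"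
    by (rule bij_betw_byWitness[where f' = F']) (use F in \<open>auto simp: isometry_pair_def\<close>)
  have "bij_betw F' (mspace V) (mspace U)"
    by (rule bij_betw_byWitness[where f' = F]) (use F in \<open>auto simp: isometry_pair_def\<close>)
  then have "bij_betw (F \<circ> (g \<circ> F')) (mspace V) (mspace V)"
    by (intro bij_betw_trans[OF _ bF] bij_betw_trans[OF _ g'(1)])
  then have "bij_betw (\<lambda>v\<in>mspace V. F (g (F' v))) (mspace V) (mspace V)"
    by (simp add: bij_betw_restrict_eq o_def)
  moreover have "preserves_dist V V (mspace V) (\<lambda>v\<in>mspace V. F (g (F' v)))"
    using F g'(2) gm by (auto simp: isometry_pair_def preserves_dist_def Pi_iff)
  ultimately show ?thesis by (simp add: isometries_def Bij_def)
qed

lemma continuous_map_mtopology_of_isometric: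
  assumes "F \<in> mspace U \<rightarrow> mspace V" "preserves_dist U V (mspace U) F"
  shows "continuous_map (mtopology_of U) (mtopology_of V) F"
proof -
  interpret U: Metric_space "mspace U" "mdist U" by simp
  interpret V: Metric_space "mspace V" "mdist V" by simp
  show ?thesis
    unfolding mtopology_of_def U.metric_continuous_map[OF V.Metric_space_axioms]
    using assms by (auto simp: preserves_dist_def)
qed

text \<open>The value at \<open>v\<close> of the conjugated map is the evaluation of
  \<open>g\<close> at \<open>F' v\<close> followed by the isometry \<open>F\<close>, hence
  continuous in \<open>g\<close>; in the pointwise topology this coordinatewise check is
  enough.\<close>

lemma conj_continuous:
  assumes F: "isometry_pair U V F F'"
  shows "continuous_map (Iso_topology U) (Iso_topology V) (\<lambda>g. \<lambda>v\<in>mspace V. F (g (F' v)))"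
proof -
  have FF: "F' v \<in> mspace U" if "v \<in> mspace V" for v using that F by (auto simp: isometry_pair_def)
  have "continuous_map (mtopology_of U) (mtopology_of V) F"
    using F by (intro continuous_map_mtopology_of_isometric) (auto simp: isometry_pair_def)
  moreover have "continuous_map (Iso_topology U) (mtopology_of U) (\<lambda>g. g (F' v))" if "v \<in> mspace V" for v
    unfolding Iso_topology_def pointwise_topology_def topspace_mtopology_of
    by (rule continuous_map_from_subtopology[OF continuous_map_product_projection]) (rule FF[OF that])
  ultimately have "continuous_map (Iso_topology U) (mtopology_of V) (\<lambda>g. F (g (F' v)))"
    if "v \<in> mspace V" for v
    using continuous_map_compose[of "Iso_topology U" "mtopology_of U" "\<lambda>g. g (F' v)"] that
    by (simp add: o_def)
  then have "continuous_map (Iso_topology U) (product_topology (\<lambda>_. mtopology_of V) (mspace V))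
      (\<lambda>g. \<lambda>v\<in>mspace V. F (g (F' v)))"
    unfolding continuous_map_componentwise by (auto cong: restrict_cong)
  then show ?thesis
    unfolding Iso_topology_def[of V] pointwise_topology_def continuous_map_in_subtopology
    using conj_isometry[OF F] by auto
qed

text \<open>The isomorphism is conjugation by the isometry. Conjugation by the reversed pair inverts
  it, so the results on conjugation serve in both directions.\<close>

lemma isometric_imp_Iso_isomorphic:
  assumes F: "isometry_pair U V F F'"
  shows "top_group_isomorphic (Iso_group U) (Iso_topology U) (Iso_group V) (Iso_topology V)"
proof -
  define h where "h = (\<lambda>g. \<lambda>v\<in>mspace V. F (g (F' v)))"
  define h' where "h' = (\<lambda>g. \<lambda>u\<in>mspace U. F' (g (F u)))"
  note F2 = isometry_pair_sym[OF F]
  have FF: "F u \<in> mspace V" "F' (F u) = u" if "u \<in> mspace U" for u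
    using that F by (auto simp: isometry_pair_def)
  have FF': "F' v \<in> mspace U" "F (F' v) = v" if "v \<in> mspace V" for v
    using that F by (auto simp: isometry_pair_def)
  have im: "g x \<in> mspace W" "g \<in> extensional (mspace W)"
    if "g \<in> isometries W" "x \<in> mspace W" for g x and W :: "'c metric"
    using that isometries_subset[of W] by (auto simp: PiE_iff)
  have ext: "g \<in> extensional (mspace W)"
    if "g \<in> isometries W" for g and W :: "'c metric"
    using that by (auto simp: isometries_def Bij_def)
  have hh': "h' (h g) = g" if "g \<in> isometries U" for g
  proof (rule extensionalityI[of _ "mspace U"])
    show "h' (h g) x = g x" if "x \<in> mspace U" for x
      using that im[OF \<open>g \<in> isometries U\<close> that] by (simp add: h_def h'_def FF)
  qed (use that ext in \<open>auto simp: h'_def\<close>)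
  have h'h: "h (h' g) = g" if "g \<in> isometries V" for g
  proof (rule extensionalityI[of _ "mspace V"])
    show "h (h' g) x = g x" if "x \<in> mspace V" for x
      using that im[OF \<open>g \<in> isometries V\<close> that] by (simp add: h_def h'_def FF')
  qed (use that ext in \<open>auto simp: h_def\<close>)
  have hI: "h g \<in> isometries V" if "g \<in> isometries U" for g
    using conj_isometry[OF F that] by (simp add: h_def)
  have hI': "h' g \<in> isometries U" if "g \<in> isometries V" for g
    using conj_isometry[OF F2 that] by (simp add: h'_def)
  have "bij_betw h (isometries U) (isometries V)"
    by (rule bij_betw_byWitness[where f' = h']) (use hh' h'h hI hI' in auto)
  moreover have "h \<in> hom (Iso_group U) (Iso_group V)"
  proof (rule homI)
    fix f g assume fg: "f \<in> carrier (Iso_group U)" "g \<in> carrier (Iso_group U)"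
    then show "h (f \<otimes>\<^bsub>Iso_group U\<^esub> g) = h f \<otimes>\<^bsub>Iso_group V\<^esub> h g"
      using im[of g U] FF FF' hI by (auto simp: mult_Iso_group h_def compose_def fun_eq_iff)
  qed (use hI in auto)
  ultimately have "h \<in> iso (Iso_group U) (Iso_group V)" by (simp add: iso_def)
  moreover have "homeomorphic_maps (Iso_topology U) (Iso_topology V) h h'"
    unfolding homeomorphic_maps_def
    using conj_continuous[OF F] conj_continuous[OF F2] hh' h'h by (simp add: h_def h'_def)
  ultimately show ?thesis
    unfolding top_group_isomorphic_def using homeomorphic_map_maps by blast
qed

section \<open>Trivial isometry groups\<close>

lemma Iso_group_trivial:
  assumes "distance_set U = {}"
  shows "isometries U = {\<lambda>x\<in>mspace U. x}"
proof -
  \<comment> \<open>Without distances there is at most one point; the empty space is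
    included.\<close>
  have eq: "x = y" if "x \<in> mspace U" "y \<in> mspace U" for x y
    using assms that by (auto simp: distance_set_def)
  have "g = (\<lambda>x\<in>mspace U. x)" if "g \<in> isometries U" for g
    using that isometries_subset[of U] eq by (intro extensionalityI[of _ "mspace U"]) (auto simp: PiE_iff)
  moreover have "(\<lambda>x\<in>mspace U. x) \<in> isometries U"
    by (auto simp: isometries_def id_Bij preserves_dist_def)
  ultimately show ?thesis by blast
qed

lemma trivial_isomorphic_Iso:
  assumes G: "topological_group G T" "carrier G = {\<one>\<^bsub>G\<^esub>}" and U: "distance_set U = {}"
  shows "top_group_isomorphic G T (Iso_group U) (Iso_topology U)"
proof -
  define i where "i = (\<lambda>x\<in>mspace U. x)"
  have I: "isometries U = {i}" using Iso_group_trivial[OF U] by (simp add: i_def)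
  interpret group G using G(1) by (simp add: topological_group_def)
  have T: "topspace T = {\<one>\<^bsub>G\<^esub>}" using G by (simp add: topological_group_def)
  have "i \<in> isometries U" using I by blast
  then have "i \<otimes>\<^bsub>Iso_group U\<^esub> i = compose (mspace U) i i" by (rule mult_Iso_group) fact
  also have "\<dots> = i" by (rule ext) (simp add: compose_def i_def)
  finally have "(\<lambda>_. i) \<in> hom G (Iso_group U)" using I by (intro homI) auto
  moreover have "bij_betw (\<lambda>_. i) (carrier G) (isometries U)"
    unfolding G(2) I by (simp add: bij_betw_def)
  ultimately have "(\<lambda>_. i) \<in> iso G (Iso_group U)" by (simp add: iso_def)
  moreover have "homeomorphic_maps T (Iso_topology U) (\<lambda>_. i) (\<lambda>_. \<one>\<^bsub>G\<^esub>)"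
    unfolding homeomorphic_maps_def continuous_map_const topspace_Iso_topology T I by simp
  ultimately show ?thesis unfolding top_group_isomorphic_def using homeomorphic_map_maps by blast
qed

lemma isomorphic_Iso_trivial:
  assumes G: "topological_group G T" and U: "distance_set U = {}"
    and iso: "top_group_isomorphic G T (Iso_group U) (Iso_topology U)"
  shows "carrier G = {\<one>\<^bsub>G\<^esub>}"
proof -
  interpret group G using G by (simp add: topological_group_def)
  obtain h where "bij_betw h (carrier G) (isometries U)"
    using iso by (auto simp: top_group_isomorphic_def iso_def)
  then have inj: "inj_on h (carrier G)" and "h ` carrier G = {\<lambda>x\<in>mspace U. x}"
    using Iso_group_trivial[OF U] by (auto simp: bij_betw_def)
  then have "h x = h \<one>\<^bsub>G\<^esub>" if "x \<in> carrier G" for x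
    using that by (metis imageI one_closed singletonD)
  then have "x = \<one>\<^bsub>G\<^esub>" if "x \<in> carrier G" for x
    using that inj one_closed by (metis inj_onD)
  then show ?thesis by blast
qed

section \<open>Ultrametrics on generalized wreath products\<close>

text \<open>Both kinds of support are treated at once. The equivalence \<open>\<phi>_le_iff\<close>
  makes \<open>\<phi>\<close> an order embedding into the reals, and thereby carries the linearity
  of the order on \<open>\<Delta>\<close>.\<close>

locale skeleton_metric =
  fixes \<Delta> :: "'d set" and r :: "'d rel" and N :: "'d \<Rightarrow> enat" and \<A> :: "'d set set" and \<phi> :: "'d \<Rightarrow> real"
  assumes skeleton: "countable_skeleton \<Delta> r N" and quasi_maximal: "quasi_maximal_skeleton \<Delta> N"
    and family: "\<A> = Fin \<Delta> \<or> \<A> = LF \<Delta> r"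
    and \<phi>_pos: "\<delta> \<in> \<Delta> \<Longrightarrow> 0 < \<phi> \<delta>"
    and \<phi>_le_iff: "\<delta> \<in> \<Delta> \<Longrightarrow> \<gamma> \<in> \<Delta> \<Longrightarrow> \<phi> \<delta> \<le> \<phi> \<gamma> \<longleftrightarrow> (\<delta>, \<gamma>) \<in> r"
begin

abbreviation S :: "('d \<Rightarrow> nat) set" where "S \<equiv> support_prod \<A> \<Delta> N"

text \<open>Inserting 0 gives \<open>d x x = 0\<close> in place of a supremum of the empty set. The
  value 0 off \<open>S\<close> makes nonnegativity and symmetry hold for all arguments.\<close>

definition d :: "('d \<Rightarrow> nat) \<Rightarrow> ('d \<Rightarrow> nat) \<Rightarrow> real" where
  "d x y = (if x \<in> S \<and> y \<in> S then Sup (insert 0 (\<phi> ` {\<gamma> \<in> \<Delta>. x \<gamma> \<noteq> y \<gamma>})) else 0)"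

definition K :: "('d \<Rightarrow> nat) metric" where "K = metric (S, d)"

lemma \<phi>_inj: "\<delta> \<in> \<Delta> \<Longrightarrow> \<gamma> \<in> \<Delta> \<Longrightarrow> \<phi> \<delta> = \<phi> \<gamma> \<Longrightarrow> \<delta> = \<gamma>"
  using skeleton \<phi>_le_iff[of \<delta> \<gamma>] \<phi>_le_iff[of \<gamma> \<delta>]
  by (auto simp: countable_skeleton_def partial_order_on_def dest: antisymD)

lemma up_set_eq: "\<delta> \<in> \<Delta> \<Longrightarrow> up_set \<Delta> r \<delta> = {\<gamma> \<in> \<Delta>. \<phi> \<delta> \<le> \<phi> \<gamma>}"
  using \<phi>_le_iff by (auto simp: up_set_def)

lemma family_finite:
  assumes "A \<in> \<A>" "\<delta> \<in> \<Delta>"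
  shows "finite (A \<inter> {\<gamma>. \<phi> \<delta> \<le> \<phi> \<gamma>})"
proof -
  have "A \<inter> {\<gamma>. \<phi> \<delta> \<le> \<phi> \<gamma>} = A \<inter> up_set \<Delta> r \<delta>"
    using assms family by (auto simp: up_set_eq Fin_def LF_def)
  then show ?thesis using assms family by (auto simp: Fin_def LF_def)
qed

lemma family_subset:
  assumes A: "A \<in> \<A>" and B: "B \<subseteq> A"
  shows "B \<in> \<A>"
proof -
  have "finite (B \<inter> X)" if "finite (A \<inter> X)" for X
    by (rule finite_subset[OF _ that]) (use B in blast)
  moreover have "finite B" if "finite A" using B that by (rule finite_subset)
  moreover have "B \<subseteq> \<Delta>" using A B family by (auto simp: Fin_def LF_def)
  ultimately show ?thesis using A family by (auto simp: Fin_def LF_def)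
qed

lemma family_Un: "A \<in> \<A> \<Longrightarrow> B \<in> \<A> \<Longrightarrow> A \<union> B \<in> \<A>"
  using family by (auto simp: Fin_def LF_def Int_Un_distrib2)

lemma finite_in_family: "finite B \<Longrightarrow> B \<subseteq> \<Delta> \<Longrightarrow> B \<in> \<A>"
  using family by (auto simp: Fin_def LF_def)

text \<open>Quasi-maximality leaves two kinds of levels: free ones, and those where
  \<open>N \<delta> = 1\<close> forces the value 0.\<close>

lemma S_iff:
  "x \<in> S \<longleftrightarrow> x \<in> extensional \<Delta> \<and> (\<forall>\<delta>\<in>\<Delta>. N \<delta> \<noteq> \<infinity> \<longrightarrow> x \<delta> = 0) \<and> supp \<Delta> x \<in> \<A>"
proof -
  have "(enat k < N \<delta>) \<longleftrightarrow> (N \<delta> \<noteq> \<infinity> \<longrightarrow> k = 0)" if "\<delta> \<in> \<Delta>" for \<delta> k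
    using that quasi_maximal by (auto simp: quasi_maximal_skeleton_def one_enat_def)
  then show ?thesis by (auto simp: support_prod_def PiE_iff)
qed

lemma S_eqI:
  assumes "x \<in> S" "y \<in> S" "\<And>\<gamma>. \<gamma> \<in> \<Delta> \<Longrightarrow> x \<gamma> = y \<gamma>"
  shows "x = y"
  using assms by (intro extensionalityI[of _ \<Delta>]) (auto simp: S_iff)

text \<open>Above any level at which \<open>x\<close> and \<open>y\<close> differ they differ at
  finitely many levels only, since both supports belong to \<open>\<A>\<close>. So there is a
  highest level of difference, and the supremum is a maximum.\<close>

lemma d_attained:
  assumes x: "x \<in> S" and y: "y \<in> S" and "x \<noteq> y"
  obtains \<delta> where "\<delta> \<in> \<Delta>" "x \<delta> \<noteq> y \<delta>" "d x y = \<phi> \<delta>"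
    "\<And>\<gamma>. \<gamma> \<in> \<Delta> \<Longrightarrow> x \<gamma> \<noteq> y \<gamma> \<Longrightarrow> \<phi> \<gamma> \<le> \<phi> \<delta>"
proof -
  obtain \<gamma> where \<gamma>: "\<gamma> \<in> \<Delta>" "x \<gamma> \<noteq> y \<gamma>" using S_eqI[OF x y] \<open>x \<noteq> y\<close> by auto
  define F where "F = {\<epsilon> \<in> \<Delta>. x \<epsilon> \<noteq> y \<epsilon> \<and> \<phi> \<gamma> \<le> \<phi> \<epsilon>}"
  have "F \<subseteq> (supp \<Delta> x \<union> supp \<Delta> y) \<inter> {\<epsilon>. \<phi> \<gamma> \<le> \<phi> \<epsilon>}" by (auto simp: F_def supp_def)
  moreover have "finite \<dots>" using x y by (intro family_finite family_Un \<gamma>) (auto simp: S_iff)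
  ultimately have fin: "finite (\<phi> ` F)" by (metis finite_imageI finite_subset)
  have ne: "\<phi> ` F \<noteq> {}" using \<gamma> by (auto simp: F_def)
  obtain \<delta> where \<delta>: "\<delta> \<in> F" "Max (\<phi> ` F) = \<phi> \<delta>" using Max_in[OF fin ne] by auto
  have max: "\<phi> \<epsilon> \<le> \<phi> \<delta>" if "\<epsilon> \<in> \<Delta>" "x \<epsilon> \<noteq> y \<epsilon>" for \<epsilon>
  proof (cases "\<phi> \<gamma> \<le> \<phi> \<epsilon>")
    case True
    then show ?thesis using that Max_ge[OF fin, of "\<phi> \<epsilon>"] \<delta>(2) by (auto simp: F_def)
  next
    case False
    then show ?thesis using \<delta>(1) by (auto simp: F_def)
  qed
  have "0 < \<phi> \<delta>" using \<delta>(1) \<phi>_pos by (auto simp: F_def)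
  then have "d x y = \<phi> \<delta>"
    unfolding d_def using x y max \<delta>(1) by (auto simp: F_def intro!: cSup_eq_maximum)
  then show ?thesis using that[of \<delta>] \<delta>(1) max by (auto simp: F_def)
qed

lemma d_self [simp]: "d x x = 0"
  by (simp add: d_def)

lemma d_le_iff:
  assumes "x \<in> S" "y \<in> S" "0 \<le> e"
  shows "d x y \<le> e \<longleftrightarrow> (\<forall>\<gamma>\<in>\<Delta>. x \<gamma> \<noteq> y \<gamma> \<longrightarrow> \<phi> \<gamma> \<le> e)"
proof (cases "x = y")
  case False
  then obtain \<delta> where \<delta>: "\<delta> \<in> \<Delta>" "x \<delta> \<noteq> y \<delta>" "d x y = \<phi> \<delta>"
    "\<And>\<gamma>. \<gamma> \<in> \<Delta> \<Longrightarrow> x \<gamma> \<noteq> y \<gamma> \<Longrightarrow> \<phi> \<gamma> \<le> \<phi> \<delta>"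
    using d_attained assms by metis
  then show ?thesis using order_trans by (metis (no_types, lifting))
qed (use assms in simp)

lemma d_less_iff:
  assumes "x \<in> S" "y \<in> S" "\<delta> \<in> \<Delta>"
  shows "d x y < \<phi> \<delta> \<longleftrightarrow> (\<forall>\<gamma>\<in>\<Delta>. \<phi> \<delta> \<le> \<phi> \<gamma> \<longrightarrow> x \<gamma> = y \<gamma>)"
proof (cases "x = y")
  case False
  then obtain \<epsilon> where \<epsilon>: "\<epsilon> \<in> \<Delta>" "x \<epsilon> \<noteq> y \<epsilon>" "d x y = \<phi> \<epsilon>"
    "\<And>\<gamma>. \<gamma> \<in> \<Delta> \<Longrightarrow> x \<gamma> \<noteq> y \<gamma> \<Longrightarrow> \<phi> \<gamma> \<le> \<phi> \<epsilon>"
    using d_attained assms by metis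
  show ?thesis
  proof
    assume "d x y < \<phi> \<delta>"
    then show "\<forall>\<gamma>\<in>\<Delta>. \<phi> \<delta> \<le> \<phi> \<gamma> \<longrightarrow> x \<gamma> = y \<gamma>" using \<epsilon>(3,4) by force
  next
    assume "\<forall>\<gamma>\<in>\<Delta>. \<phi> \<delta> \<le> \<phi> \<gamma> \<longrightarrow> x \<gamma> = y \<gamma>"
    then show "d x y < \<phi> \<delta>" using \<epsilon>(1-3) by force
  qed
qed (use assms \<phi>_pos in simp)

text \<open>Since the supremum is attained, a distance strictly below \<open>\<phi> \<delta>\<close>
  means that no difference occurs at \<open>\<delta>\<close> or above. This turns the defining
  condition of the wreath product into one on distances.\<close>

lemma restrict_up_set_eq_iff:
  assumes "x \<in> S" "y \<in> S" "\<delta> \<in> \<Delta>"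
  shows "restrict x (up_set \<Delta> r \<delta>) = restrict y (up_set \<Delta> r \<delta>) \<longleftrightarrow> d x y < \<phi> \<delta>"
proof -
  have "restrict x A = restrict y A \<longleftrightarrow> (\<forall>i\<in>A. x i = y i)" for A :: "'d set"
    unfolding fun_eq_iff restrict_def by auto
  then show ?thesis using assms by (auto simp: d_less_iff up_set_eq)
qed

lemma d_nonneg: "0 \<le> d x y"
proof (cases "x \<in> S \<and> y \<in> S \<and> x \<noteq> y")
  case True
  then show ?thesis using d_attained[of x y] \<phi>_pos by (metis less_imp_le)
qed (auto simp: d_def)

text \<open>A level at which \<open>x\<close> and \<open>z\<close> differ is one at which
  \<open>x\<close> and \<open>y\<close> differ or \<open>y\<close> and \<open>z\<close>
  differ.\<close>

lemma d_ultra: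
  assumes "x \<in> S" "y \<in> S" "z \<in> S"
  shows "d x z \<le> max (d x y) (d y z)"
proof -
  have "\<phi> \<gamma> \<le> max (d x y) (d y z)" if "\<gamma> \<in> \<Delta>" "x \<gamma> \<noteq> z \<gamma>" for \<gamma>
  proof (cases "x \<gamma> = y \<gamma>")
    case True
    then have "\<phi> \<gamma> \<le> d y z" using that d_le_iff[OF assms(2,3) d_nonneg] by auto
    then show ?thesis by simp
  next
    case False
    then have "\<phi> \<gamma> \<le> d x y" using that d_le_iff[OF assms(1,2) d_nonneg] by auto
    then show ?thesis by simp
  qed
  then show ?thesis using assms d_nonneg[of x y] by (subst d_le_iff) (auto simp: le_max_iff_disj)
qed

lemma d_commute: "d x y = d y x"
proof -
  have "{\<gamma> \<in> \<Delta>. x \<gamma> \<noteq> y \<gamma>} = {\<gamma> \<in> \<Delta>. y \<gamma> \<noteq> x \<gamma>}" by auto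
  then show ?thesis by (simp add: d_def conj_commute)
qed

sublocale Metric_space S d
proof
  show "d x y = 0 \<longleftrightarrow> x = y" if "x \<in> S" "y \<in> S" for x y
    using that d_attained[of x y] \<phi>_pos by (metis d_self less_irrefl)
  show "d x z \<le> d x y + d y z" if "x \<in> S" "y \<in> S" "z \<in> S" for x y z
    using d_ultra[OF that] d_nonneg[of x y] d_nonneg[of y z] by linarith
qed (auto simp: d_nonneg d_commute)

section \<open>Isometry group, distances, wideness and homogeneity of the model space\<close>

lemma mspace_K [simp]: "mspace K = S" and mdist_K [simp]: "mdist K = d"
  by (simp_all add: K_def)

text \<open>A distance is 0 or some \<open>\<phi> \<delta>\<close>, so its comparisons with all
  \<open>\<phi> \<delta>\<close> determine it: if two distances differ, the larger one is positive,
  hence equal to some \<open>\<phi> \<delta>\<close>, and the comparison with that value separates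
  them.\<close>

lemma isometries_K: "isometries K = Wr_set \<A> \<Delta> r N"
proof -
  have iff: "preserves_dist K K S g \<longleftrightarrow>
      (\<forall>x\<in>S. \<forall>y\<in>S. \<forall>\<delta>\<in>\<Delta>. d x y < \<phi> \<delta> \<longleftrightarrow> d (g x) (g y) < \<phi> \<delta>)" if g: "g \<in> Bij S" for g
  proof
    assume R: "\<forall>x\<in>S. \<forall>y\<in>S. \<forall>\<delta>\<in>\<Delta>. d x y < \<phi> \<delta> \<longleftrightarrow> d (g x) (g y) < \<phi> \<delta>"
    have val: "d u v = 0 \<or> (\<exists>\<delta>\<in>\<Delta>. d u v = \<phi> \<delta>)" if "u \<in> S" "v \<in> S" for u v
      using that d_attained[of u v] by (cases "u = v") (simp, metis)
    have "d (g x) (g y) = d x y" if xy: "x \<in> S" "y \<in> S" for x y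
    proof (rule ccontr)
      assume ne: "d (g x) (g y) \<noteq> d x y"
      have gm: "g x \<in> S" "g y \<in> S" using Bij_imp_funcset[OF g] xy by auto
      from ne consider "d (g x) (g y) < d x y" | "d x y < d (g x) (g y)" by linarith
      then show False
      proof cases
        case 1
        then have "d x y \<noteq> 0" using d_nonneg[of "g x" "g y"] by linarith
        then show False using val[OF xy] R xy 1 by (metis less_irrefl)
      next
        case 2
        then have "d (g x) (g y) \<noteq> 0" using d_nonneg[of x y] by linarith
        then show False using val[OF gm] R xy 2 by (metis less_irrefl)
      qed
    qed
    then show "preserves_dist K K S g" by (simp add: preserves_dist_def)
  qed (simp add: preserves_dist_def)
  have "g \<in> isometries K \<longleftrightarrow> g \<in> Wr_set \<A> \<Delta> r N" for g
  proof (cases "g \<in> Bij S")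
    case True
    then have "g x \<in> S" if "x \<in> S" for x using Bij_imp_funcset that by auto
    then show ?thesis
      using True by (auto simp: isometries_def Wr_set_def restrict_up_set_eq_iff iff)
  qed (simp add: isometries_def Wr_set_def)
  then show ?thesis by blast
qed

lemma Iso_group_K: "Iso_group K = Wr_group \<A> \<Delta> r N"
  by (simp add: Iso_group_def Wr_group_def isometries_K)

lemma zero_in_S: "(\<lambda>\<gamma>\<in>\<Delta>. 0) \<in> S"
proof -
  have "supp \<Delta> (\<lambda>\<gamma>\<in>\<Delta>. 0) = {}" by (auto simp: supp_def)
  then show ?thesis by (simp add: S_iff finite_in_family)
qed

definition unit_vec :: "'d \<Rightarrow> nat \<Rightarrow> 'd \<Rightarrow> nat" where
  "unit_vec \<delta> k = (\<lambda>\<gamma>\<in>\<Delta>. if \<gamma> = \<delta> then k else 0)"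

lemma unit_vec_in_S: "\<delta> \<in> \<Delta> \<Longrightarrow> N \<delta> = \<infinity> \<Longrightarrow> unit_vec \<delta> k \<in> S"
proof -
  assume "\<delta> \<in> \<Delta>" "N \<delta> = \<infinity>"
  moreover have "supp \<Delta> (unit_vec \<delta> k) \<subseteq> {\<delta>}" by (auto simp: supp_def unit_vec_def)
  moreover have "{\<delta>} \<in> \<A>" using \<open>\<delta> \<in> \<Delta>\<close> by (intro finite_in_family) auto
  ultimately show ?thesis using family_subset by (auto simp: S_iff unit_vec_def)
qed

lemma d_unit_vec:
  assumes "\<delta> \<in> \<Delta>" "N \<delta> = \<infinity>" "j \<noteq> k"
  shows "d (unit_vec \<delta> j) (unit_vec \<delta> k) = \<phi> \<delta>"
proof -
  have "unit_vec \<delta> j \<delta> \<noteq> unit_vec \<delta> k \<delta>" using assms by (simp add: unit_vec_def)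
  then obtain \<epsilon> where "unit_vec \<delta> j \<epsilon> \<noteq> unit_vec \<delta> k \<epsilon>" "d (unit_vec \<delta> j) (unit_vec \<delta> k) = \<phi> \<epsilon>"
    using d_attained[OF unit_vec_in_S[OF assms(1,2)] unit_vec_in_S[OF assms(1,2)], of j k] by metis
  then show ?thesis by (auto simp: unit_vec_def split: if_splits)
qed

lemma distance_set_K: "distance_set K = \<phi> ` {\<delta> \<in> \<Delta>. N \<delta> = \<infinity>}"
proof (intro subset_antisym subsetI)
  fix e assume "e \<in> distance_set K"
  then obtain x y where xy: "x \<in> S" "y \<in> S" "x \<noteq> y" "e = d x y" by (auto simp: distance_set_def)
  then obtain \<delta> where "\<delta> \<in> \<Delta>" "x \<delta> \<noteq> y \<delta>" "e = \<phi> \<delta>" using d_attained[OF xy(1-3)] by metis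
  moreover from this have "N \<delta> = \<infinity>" using xy(1,2) unfolding S_iff by metis
  ultimately show "e \<in> \<phi> ` {\<delta> \<in> \<Delta>. N \<delta> = \<infinity>}" by blast
next
  fix e assume "e \<in> \<phi> ` {\<delta> \<in> \<Delta>. N \<delta> = \<infinity>}"
  then obtain \<delta> where \<delta>: "\<delta> \<in> \<Delta>" "N \<delta> = \<infinity>" "e = \<phi> \<delta>" by blast
  have 01: "e = d (unit_vec \<delta> 0) (unit_vec \<delta> 1)" using d_unit_vec[OF \<delta>(1,2), of 0 1] \<delta>(3) by simp
  then have "unit_vec \<delta> 0 \<noteq> unit_vec \<delta> 1" using \<phi>_pos[OF \<delta>(1)] \<delta>(3) by auto
  with 01 show "e \<in> distance_set K"
    unfolding distance_set_def mspace_K mdist_K using unit_vec_in_S[OF \<delta>(1,2)] by blast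
qed

text \<open>The points supported at the single level \<open>\<delta>\<close> form an infinite set,
  and any two of them differ exactly there.\<close>

lemma wide_K: "wide K"
  unfolding wide_def distance_set_K mspace_K mdist_K
proof
  fix e assume "e \<in> \<phi> ` {\<delta> \<in> \<Delta>. N \<delta> = \<infinity>}"
  then obtain \<delta> where \<delta>: "\<delta> \<in> \<Delta>" "N \<delta> = \<infinity>" "e = \<phi> \<delta>" by blast
  have "inj (unit_vec \<delta>)"
  proof (rule injI)
    fix j k assume "unit_vec \<delta> j = unit_vec \<delta> k"
    then have "unit_vec \<delta> j \<delta> = unit_vec \<delta> k \<delta>" by simp
    then show "j = k" using \<delta>(1) by (simp add: unit_vec_def)
  qed
  then have "infinite (range (unit_vec \<delta>))" by (simp add: finite_image_iff)
  then show "\<exists>A\<subseteq>S. countable A \<and> infinite A \<and> (\<forall>x\<in>A. \<forall>y\<in>A. x \<noteq> y \<longrightarrow> d x y = e)"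
    using unit_vec_in_S[OF \<delta>(1,2)] d_unit_vec[OF \<delta>(1,2)] \<delta>(3)
    by (intro exI[of _ "range (unit_vec \<delta>)"]) (auto, metis)
qed

lemma homogeneous_K: "homogeneous K"
  unfolding homogeneous_def mspace_K
proof (intro ballI)
  fix x y assume x: "x \<in> S" and y: "y \<in> S"
  \<comment> \<open>Exchanging the values of \<open>x\<close> and \<open>y\<close> in every
    coordinate is an involution, and it preserves the set of levels at which two points
    differ.\<close>
  define f where "f z = (\<lambda>\<gamma>\<in>\<Delta>. Transposition.transpose (x \<gamma>) (y \<gamma>) (z \<gamma>))" for z
  have fS: "f z \<in> S" if z: "z \<in> S" for z
  proof -
    \<comment> \<open>Where \<open>x\<close>, \<open>y\<close> and \<open>z\<close> all vanish, the
      exchange fixes the value 0.\<close>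
    have "supp \<Delta> (f z) \<subseteq> supp \<Delta> x \<union> supp \<Delta> y \<union> supp \<Delta> z"
      by (auto simp: supp_def f_def Transposition.transpose_def split: if_splits)
    moreover have "\<dots> \<in> \<A>" using x y z by (intro family_Un) (auto simp: S_iff)
    ultimately have "supp \<Delta> (f z) \<in> \<A>" by (metis family_subset)
    then show ?thesis using x y z by (auto simp: S_iff f_def)
  qed
  have ff: "f (f z) = z" if "z \<in> S" for z
  proof (rule S_eqI[OF fS[OF fS[OF that]] that])
    show "f (f z) \<gamma> = z \<gamma>" if "\<gamma> \<in> \<Delta>" for \<gamma> using that by (simp add: f_def)
  qed
  have fd: "d (f z) (f w) = d z w" if "z \<in> S" "w \<in> S" for z w
  proof -
    have "{\<gamma> \<in> \<Delta>. f z \<gamma> \<noteq> f w \<gamma>} = {\<gamma> \<in> \<Delta>. z \<gamma> \<noteq> w \<gamma>}"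
      by (auto simp: f_def dest: transpose_eq_imp_eq)
    then show ?thesis using that fS by (simp add: d_def)
  qed
  have "isometry_pair K K f f"
    using fS ff fd by (auto simp: isometry_pair_def preserves_dist_def)
  then have "restrict f S \<in> isometries K" using isometry_pair_isometries by fastforce
  moreover have "f x = y" by (rule S_eqI[OF fS[OF x] y]) (simp add: f_def)
  ultimately show "\<exists>g\<in>isometries K. g x = y" using x by (intro bexI[of _ "restrict f S"]) simp_all
qed

section \<open>Separability, completeness and topology of the model space\<close>

lemma countable_finite_supp: "countable {x \<in> S. finite (supp \<Delta> x)}"
proof -
  \<comment> \<open>\<open>G x\<close> records the nonzero coordinates: a finite subset of a
    countable set which determines the point.\<close>
  define G where "G x = (\<lambda>\<gamma>. (\<gamma>, x \<gamma>)) ` supp \<Delta> x" for x :: "'d \<Rightarrow> nat"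
  have "countable \<Delta>" using skeleton by (simp add: countable_skeleton_def)
  then have "countable {F. finite F \<and> F \<subseteq> \<Delta> \<times> (UNIV :: nat set)}"
    by (intro countable_Collect_finite_subset) simp
  moreover have "G ` {x \<in> S. finite (supp \<Delta> x)} \<subseteq> {F. finite F \<and> F \<subseteq> \<Delta> \<times> UNIV}"
    by (auto simp: G_def supp_def)
  ultimately have "countable (G ` {x \<in> S. finite (supp \<Delta> x)})" by (rule countable_subset[rotated])
  moreover have "inj_on G {x \<in> S. finite (supp \<Delta> x)}"
  proof (rule inj_onI)
    fix x y assume xy: "x \<in> {x \<in> S. finite (supp \<Delta> x)}" "y \<in> {x \<in> S. finite (supp \<Delta> x)}" "G x = G y"
    have G: "z \<gamma> = n \<longleftrightarrow> (\<gamma>, n) \<in> G z" if "\<gamma> \<in> \<Delta>" "n \<noteq> 0" for z \<gamma> n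
      using that by (auto simp: G_def supp_def)
    have "x \<gamma> = y \<gamma>" if "\<gamma> \<in> \<Delta>" for \<gamma>
      using G[OF that, of "x \<gamma>" x] G[OF that, of "x \<gamma>" y] G[OF that, of "y \<gamma>" x] G[OF that, of "y \<gamma>" y] xy(3)
      by (cases "x \<gamma> = 0"; cases "y \<gamma> = 0") auto
    then show "x = y" using xy by (intro S_eqI) auto
  qed
  ultimately show ?thesis by (rule countable_image_inj_on)
qed

lemma Polish_ultrametric_K_iff:
  "Polish_ultrametric K \<longleftrightarrow> separable_space (mtopology_of K) \<and> mcomplete_of K"
  unfolding Polish_ultrametric_def using d_ultra by auto

lemma Fin_mtopology:
  assumes c: "0 < c" "\<And>\<delta>. \<delta> \<in> \<Delta> \<Longrightarrow> c \<le> \<phi> \<delta>"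
  shows "mtopology_of K = discrete_topology S"
proof -
  have eq: "x = y" if "x \<in> S" "y \<in> S" "d x y < c" for x y
    using that c(2) d_attained[of x y] by (metis not_less)
  have "openin mtopology {x}" if "x \<in> S" for x
    unfolding openin_mtopology using that eq[OF that, symmetric] c(1) by (auto intro!: exI[of _ c])
  then have "mtopology = discrete_topology S"
    using discrete_topology_unique[of S mtopology] by auto
  then show ?thesis by (simp add: K_def)
qed

text \<open>Distinct points are at least \<open>c\<close> apart, so Cauchy sequences are eventually
  constant; and there are only countably many finitely supported points.\<close>

lemma Fin_Polish:
  assumes Fin: "\<A> = Fin \<Delta>" and c: "0 < c" "\<And>\<delta>. \<delta> \<in> \<Delta> \<Longrightarrow> c \<le> \<phi> \<delta>"
  shows "Polish_ultrametric K"
  unfolding Polish_ultrametric_K_iff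
proof
  have eq: "x = y" if "x \<in> S" "y \<in> S" "d x y < c" for x y
    using that c(2) d_attained[of x y] by (metis not_less)
  have "finite (supp \<Delta> x)" if "x \<in> S" for x using that Fin unfolding S_iff by (simp add: Fin_def)
  then have "{x \<in> S. finite (supp \<Delta> x)} = S" by blast
  then have "countable S" using countable_finite_supp by simp
  then show "separable_space (mtopology_of K)"
    unfolding separable_space_mtopology_of_iff mspace_K mdist_K
    by (intro exI[of _ S]) (auto intro!: bexI)
  show "mcomplete_of K"
    unfolding mcomplete_of_iff mspace_K mdist_K
  proof (intro allI impI)
    fix s :: "nat \<Rightarrow> 'd \<Rightarrow> nat"
    assume s: "(\<forall>n. s n \<in> S) \<and> (\<forall>e>0. \<exists>N. \<forall>m\<ge>N. \<forall>n\<ge>N. d (s m) (s n) < e)"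
    then obtain N where "\<forall>m\<ge>N. \<forall>n\<ge>N. d (s m) (s n) < c" using c(1) by meson
    then have "d (s n) (s N) = 0" if "n \<ge> N" for n using that s eq[of "s n" "s N"] by simp
    then have "\<forall>n\<ge>N. d (s n) (s N) < e" if "e > 0" for e using that by simp
    moreover have "s N \<in> S" using s by simp
    ultimately show "\<exists>x\<in>S. \<forall>e>0. \<exists>N. \<forall>n\<ge>N. d (s n) x < e" by (intro bexI[of _ "s N"]) auto
  qed
qed

text \<open>Either \<open>\<phi> \<gamma>\<close> is itself below \<open>e\<close>, or it is the
  least value, and then a distance below it means equality of the points.\<close>

lemma small_level:
  assumes fine: "\<And>e. e > 0 \<Longrightarrow> \<exists>\<gamma>\<in>\<Delta>. \<phi> \<gamma> < e \<or> (\<forall>\<delta>\<in>\<Delta>. \<phi> \<gamma> \<le> \<phi> \<delta>)" and e: "e > 0"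
  obtains \<gamma> where "\<gamma> \<in> \<Delta>" "\<And>x y. x \<in> S \<Longrightarrow> y \<in> S \<Longrightarrow> d x y < \<phi> \<gamma> \<Longrightarrow> d x y < e"
proof -
  obtain \<gamma> where \<gamma>: "\<gamma> \<in> \<Delta>" "\<phi> \<gamma> < e \<or> (\<forall>\<delta>\<in>\<Delta>. \<phi> \<gamma> \<le> \<phi> \<delta>)" using fine[OF e] by auto
  have "d x y < e" if xy: "x \<in> S" "y \<in> S" "d x y < \<phi> \<gamma>" for x y
  proof (cases "x = y")
    case False
    obtain \<delta> where "\<delta> \<in> \<Delta>" "d x y = \<phi> \<delta>" using d_attained[OF xy(1,2) False] by metis
    then show ?thesis using \<gamma>(2) xy(3) by force
  qed (use e in simp)
  then show ?thesis using that[of \<gamma>] \<gamma>(1) by simp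
qed

text \<open>The generating sets are the open balls with radii \<open>\<phi> \<gamma>\<close>, and
  \<open>fine\<close> supplies one of them inside every ball with the same centre.\<close>

lemma LF_mtopology:
  assumes fine: "\<And>e. e > 0 \<Longrightarrow> \<exists>\<gamma>\<in>\<Delta>. \<phi> \<gamma> < e \<or> (\<forall>\<delta>\<in>\<Delta>. \<phi> \<gamma> \<le> \<phi> \<delta>)"
  shows "mtopology_of K = support_prod_topology \<A> \<Delta> r N"
proof -
  define B where "B = {{y \<in> S. restrict y (up_set \<Delta> r \<gamma>) = restrict x (up_set \<Delta> r \<gamma>)} | x \<gamma>. x \<in> S \<and> \<gamma> \<in> \<Delta>}"
  have ball: "{y \<in> S. restrict y (up_set \<Delta> r \<gamma>) = restrict x (up_set \<Delta> r \<gamma>)} = mball x (\<phi> \<gamma>)"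
    if "x \<in> S" "\<gamma> \<in> \<Delta>" for x \<gamma>
    using that by (auto simp: restrict_up_set_eq_iff d_commute)
  have B: "B = {mball x (\<phi> \<gamma>) | x \<gamma>. x \<in> S \<and> \<gamma> \<in> \<Delta>}"
    unfolding B_def using ball by (intro Collect_cong ex_cong1) (metis (no_types, lifting))
  have "openin mtopology W \<longleftrightarrow> openin (topology_generated_by B) W" for W
  proof
    assume W: "openin mtopology W"
    show "openin (topology_generated_by B) W"
    proof (subst openin_subopen, intro ballI)
      fix x assume x: "x \<in> W"
      then obtain e where e: "e > 0" "mball x e \<subseteq> W" using W by (auto simp: openin_mtopology)
      have xS: "x \<in> S" using W x by (auto simp: openin_mtopology)
      obtain \<gamma> where \<gamma>: "\<gamma> \<in> \<Delta>" "\<And>x y. x \<in> S \<Longrightarrow> y \<in> S \<Longrightarrow> d x y < \<phi> \<gamma> \<Longrightarrow> d x y < e"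
        using small_level[OF fine e(1)] by metis
      have "mball x (\<phi> \<gamma>) \<subseteq> W" using \<gamma>(2) e(2) by (auto simp: subset_iff)
      moreover have "openin (topology_generated_by B) (mball x (\<phi> \<gamma>))"
        using xS \<gamma>(1) by (intro topology_generated_by_Basis) (auto simp: B)
      moreover have "x \<in> mball x (\<phi> \<gamma>)" using xS \<phi>_pos[OF \<gamma>(1)] by simp
      ultimately show "\<exists>T. openin (topology_generated_by B) T \<and> x \<in> T \<and> T \<subseteq> W" by blast
    qed
  next
    assume "openin (topology_generated_by B) W"
    then have "generate_topology_on B W" by (rule openin_topology_generated_by)
    then show "openin mtopology W"
      by (rule generate_topology_on_coarsest[rotated 2]) (auto simp: B)
  qed
  then have "mtopology = topology_generated_by B" by (simp add: topology_eq)
  then show ?thesis by (simp add: K_def support_prod_topology_def B_def)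
qed

lemma LF_Polish:
  assumes LF: "\<A> = LF \<Delta> r"
    and fine: "\<And>e. e > 0 \<Longrightarrow> \<exists>\<gamma>\<in>\<Delta>. \<phi> \<gamma> < e \<or> (\<forall>\<delta>\<in>\<Delta>. \<phi> \<gamma> \<le> \<phi> \<delta>)"
  shows "Polish_ultrametric K"
  unfolding Polish_ultrametric_K_iff
proof
  show "separable_space (mtopology_of K)"
    unfolding separable_space_mtopology_of_iff mspace_K mdist_K
  proof (intro exI conjI ballI allI impI)
    show "countable {x \<in> S. finite (supp \<Delta> x)}" by (rule countable_finite_supp)
    show "{x \<in> S. finite (supp \<Delta> x)} \<subseteq> S" by blast
    fix x and e :: real assume x: "x \<in> S" and e: "e > 0"
    obtain \<gamma> where \<gamma>: "\<gamma> \<in> \<Delta>" "\<And>x y. x \<in> S \<Longrightarrow> y \<in> S \<Longrightarrow> d x y < \<phi> \<gamma> \<Longrightarrow> d x y < e"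
      using small_level[OF fine e] by metis
    \<comment> \<open>Replacing \<open>x\<close> by 0 at the levels below \<open>\<gamma>\<close>
      leaves a finite support, and the distance to \<open>x\<close> is below
      \<open>\<phi> \<gamma>\<close>.\<close>
    define c where "c = (\<lambda>\<delta>\<in>\<Delta>. if \<phi> \<gamma> \<le> \<phi> \<delta> then x \<delta> else 0)"
    have sc: "supp \<Delta> c = supp \<Delta> x \<inter> {\<delta>. \<phi> \<gamma> \<le> \<phi> \<delta>}" by (auto simp: supp_def c_def)
    then have fin: "finite (supp \<Delta> c)" using x \<gamma>(1) family_finite by (auto simp: S_iff)
    have "supp \<Delta> c \<in> \<A>" by (intro finite_in_family fin) (auto simp: supp_def)
    then have cS: "c \<in> S" using x by (auto simp: S_iff c_def)
    have "d x c < \<phi> \<gamma>" using x cS \<gamma>(1) by (subst d_less_iff) (auto simp: c_def)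
    then show "\<exists>c\<in>{x \<in> S. finite (supp \<Delta> x)}. d x c < e" using \<gamma>(2)[OF x cS] cS fin by auto
  qed
  show "mcomplete_of K"
    unfolding mcomplete_of_iff mspace_K mdist_K
  proof (intro allI impI)
    fix s :: "nat \<Rightarrow> 'd \<Rightarrow> nat"
    assume s: "(\<forall>n. s n \<in> S) \<and> (\<forall>e>0. \<exists>N. \<forall>m\<ge>N. \<forall>n\<ge>N. d (s m) (s n) < e)"
    have "\<exists>M. \<forall>m\<ge>M. \<forall>n\<ge>M. d (s m) (s n) < \<phi> \<gamma>" if "\<gamma> \<in> \<Delta>" for \<gamma>
      using s \<phi>_pos[OF that] by simp
    \<comment> \<open>From index \<open>M \<gamma>\<close> on, the sequence is constant at every
      level from \<open>\<gamma>\<close> upwards.\<close>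
    then obtain M where M: "\<And>\<gamma> m n. \<gamma> \<in> \<Delta> \<Longrightarrow> m \<ge> M \<gamma> \<Longrightarrow> n \<ge> M \<gamma> \<Longrightarrow> d (s m) (s n) < \<phi> \<gamma>"
      by metis
    have stable: "s m \<delta> = s n \<delta>" if "\<gamma> \<in> \<Delta>" "\<delta> \<in> \<Delta>" "\<phi> \<gamma> \<le> \<phi> \<delta>" "m \<ge> M \<gamma>" "n \<ge> M \<gamma>" for \<gamma> \<delta> m n
      using M[OF that(1,4,5)] d_less_iff[of "s m" "s n" \<gamma>] s that by auto
    \<comment> \<open>The limit takes at each level the value on which the sequence settles
      there.\<close>
    define x where "x = (\<lambda>\<delta>\<in>\<Delta>. s (M \<delta>) \<delta>)"
    have x_eq: "x \<delta> = s n \<delta>" if "\<gamma> \<in> \<Delta>" "\<delta> \<in> \<Delta>" "\<phi> \<gamma> \<le> \<phi> \<delta>" "n \<ge> M \<gamma>" for \<gamma> \<delta> n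
    proof -
      have "x \<delta> = s (max n (M \<delta>)) \<delta>"
        using stable[of \<delta> \<delta> "M \<delta>" "max n (M \<delta>)"] that by (simp add: x_def)
      also have "\<dots> = s n \<delta>" using stable[OF that(1-3), of "max n (M \<delta>)" n] that(4) by simp
      finally show ?thesis .
    qed
    \<comment> \<open>From \<open>\<gamma>\<close> upwards the limit agrees with one term of the
      sequence, so its support is finite there. The whole support may be infinite, which is where
      \<open>LF\<close> enters.\<close>
    have "finite (supp \<Delta> x \<inter> up_set \<Delta> r \<gamma>)" if "\<gamma> \<in> \<Delta>" for \<gamma>
    proof -
      have "supp \<Delta> x \<inter> up_set \<Delta> r \<gamma> \<subseteq> supp \<Delta> (s (M \<gamma>)) \<inter> {\<delta>. \<phi> \<gamma> \<le> \<phi> \<delta>}"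
        using x_eq[OF that _ _ order_refl] that by (auto simp: supp_def up_set_eq)
      moreover have "finite \<dots>" using s that family_finite by (auto simp: S_iff)
      ultimately show ?thesis by (rule finite_subset)
    qed
    then have "supp \<Delta> x \<in> \<A>" by (auto simp: LF LF_def supp_def)
    moreover have "x \<delta> = 0" if "\<delta> \<in> \<Delta>" "N \<delta> \<noteq> \<infinity>" for \<delta>
      using that s by (simp add: x_def S_iff)
    ultimately have xS: "x \<in> S" by (simp add: S_iff x_def)
    have "\<exists>N. \<forall>n\<ge>N. d (s n) x < e" if e: "e > 0" for e
    proof -
      obtain \<gamma> where \<gamma>: "\<gamma> \<in> \<Delta>" "\<And>x y. x \<in> S \<Longrightarrow> y \<in> S \<Longrightarrow> d x y < \<phi> \<gamma> \<Longrightarrow> d x y < e"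
        using small_level[OF fine e] by metis
      have "d (s n) x < \<phi> \<gamma>" if "n \<ge> M \<gamma>" for n
        using s xS \<gamma>(1) x_eq[OF \<gamma>(1) _ _ that] by (subst d_less_iff) auto
      then show ?thesis using \<gamma>(2) s xS by blast
    qed
    with xS show "\<exists>x\<in>S. \<forall>e>0. \<exists>N. \<forall>n\<ge>N. d (s n) x < e" by blast
  qed
qed

lemma Iso_topology_K_LF:
  assumes "\<And>e. e > 0 \<Longrightarrow> \<exists>\<gamma>\<in>\<Delta>. \<phi> \<gamma> < e \<or> (\<forall>\<delta>\<in>\<Delta>. \<phi> \<gamma> \<le> \<phi> \<delta>)"
  shows "Iso_topology K = Wr_topology \<A> \<Delta> r N"
  by (simp add: Iso_topology_def Wr_topology_def isometries_K LF_mtopology[OF assms])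

lemma Iso_topology_K_Fin:
  assumes "\<A> = Fin \<Delta>" "0 < c" "\<And>\<delta>. \<delta> \<in> \<Delta> \<Longrightarrow> c \<le> \<phi> \<delta>"
  shows "Iso_topology K = tau_star \<Delta> r N"
proof -
  have "mtopology_of K = discrete_topology S" by (rule Fin_mtopology) (use assms in auto)
  then show ?thesis unfolding Iso_topology_def tau_star_def isometries_K assms(1)[symmetric] by simp
qed

end

section \<open>Skeletons of real numbers\<close>

text \<open>The levels are the numbers in \<open>X\<close>, coded by naturals. Those outside
  \<open>D\<close> receive \<open>N \<delta> = 1\<close>, so that \<open>X\<close> may contain extra
  levels without adding distances to the model space.\<close>

lemma real_skeleton:
  fixes X :: "real set"
  assumes X: "countable X" "X \<noteq> {}" and D: "D \<subseteq> X"
  obtains \<Delta> :: "nat set" and r N \<phi> where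
    "countable_skeleton \<Delta> r N" "linear_order_on \<Delta> r" "quasi_maximal_skeleton \<Delta> N"
    "\<phi> ` \<Delta> = X" "\<phi> ` {\<delta> \<in> \<Delta>. N \<delta> = \<infinity>} = D"
    "\<forall>\<delta>\<in>\<Delta>. \<forall>\<gamma>\<in>\<Delta>. \<phi> \<delta> \<le> \<phi> \<gamma> \<longleftrightarrow> (\<delta>, \<gamma>) \<in> r"
proof -
  define \<Delta> where "\<Delta> = to_nat_on X ` X"
  define \<phi> where "\<phi> = from_nat_into X"
  define r where "r = {(\<delta>, \<gamma>) \<in> \<Delta> \<times> \<Delta>. \<phi> \<delta> \<le> \<phi> \<gamma>}"
  define N :: "nat \<Rightarrow> enat" where "N \<delta> = (if \<phi> \<delta> \<in> D then \<infinity> else 1)" for \<delta>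
  have \<phi>: "\<phi> (to_nat_on X x) = x" if "x \<in> X" for x
    using X(1) that by (simp add: \<phi>_def)
  have im: "\<phi> ` \<Delta> = X" using \<phi> by (force simp: \<Delta>_def)
  have inj: "\<delta> = \<gamma>" if "\<delta> \<in> \<Delta>" "\<gamma> \<in> \<Delta>" "\<phi> \<delta> = \<phi> \<gamma>" for \<delta> \<gamma>
    using that \<phi> by (auto simp: \<Delta>_def)
  have lin: "linear_order_on \<Delta> r"
    unfolding linear_order_on_def partial_order_on_def preorder_on_def
    by (auto simp: r_def refl_on_def total_on_def intro!: transI antisymI inj)
  have "countable_skeleton \<Delta> r N"
    using X lin by (auto simp: countable_skeleton_def linear_order_on_def \<Delta>_def N_def)
  moreover have "quasi_maximal_skeleton \<Delta> N" by (simp add: quasi_maximal_skeleton_def N_def)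
  moreover have "\<phi> ` {\<delta> \<in> \<Delta>. N \<delta> = \<infinity>} = D"
  proof -
    have "{\<delta> \<in> \<Delta>. N \<delta> = \<infinity>} = {\<delta> \<in> \<Delta>. \<phi> \<delta> \<in> D}" by (auto simp: N_def)
    then show ?thesis using im D by auto
  qed
  ultimately show ?thesis using that[of \<Delta> r N \<phi>] lin im by (auto simp: r_def)
qed

text \<open>With \<^term>\<open>\<phi> \<delta>\<close> the sum of \<open>2\<^sup>-\<^sup>n\<close> over the \<open>n \<le> \<delta>\<close> in the order \<open>r\<close>, small values of \<open>\<phi>\<close>
  occur automatically: the sum over the elements below \<open>\<delta>\<close> is a tail of the series once \<open>\<delta>\<close> lies below
  the first few elements of the enumeration.\<close>

lemma linear_skeleton_real_embedding:
  fixes \<Delta> :: "nat set"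
  assumes sk: "countable_skeleton \<Delta> r N" and lin: "linear_order_on \<Delta> r"
  obtains \<phi> :: "nat \<Rightarrow> real" where "\<forall>\<delta>\<in>\<Delta>. 0 < \<phi> \<delta>"
    "\<forall>\<delta>\<in>\<Delta>. \<forall>\<gamma>\<in>\<Delta>. \<phi> \<delta> \<le> \<phi> \<gamma> \<longleftrightarrow> (\<delta>, \<gamma>) \<in> r"
    "\<forall>e>0. \<exists>\<gamma>\<in>\<Delta>. \<phi> \<gamma> < e \<or> (\<forall>\<delta>\<in>\<Delta>. \<phi> \<gamma> \<le> \<phi> \<delta>)"
proof -
  have refl: "(\<delta>, \<delta>) \<in> r" if "\<delta> \<in> \<Delta>" for \<delta>
    using lin that by (auto simp: order_on_defs refl_on_def)
  have trans: "(\<delta>, \<epsilon>) \<in> r" if "(\<delta>, \<gamma>) \<in> r" "(\<gamma>, \<epsilon>) \<in> r" for \<delta> \<gamma> \<epsilon>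
    using lin that by (meson order_on_defs(1-3) transD)
  have antisym: "\<delta> = \<gamma>" if "(\<delta>, \<gamma>) \<in> r" "(\<gamma>, \<delta>) \<in> r" for \<delta> \<gamma>
    using lin that by (meson order_on_defs(1-3) antisymD)
  have total: "(\<delta>, \<gamma>) \<in> r \<or> (\<gamma>, \<delta>) \<in> r" if "\<delta> \<in> \<Delta>" "\<gamma> \<in> \<Delta>" for \<delta> \<gamma>
    using lin that refl by (cases "\<delta> = \<gamma>") (auto simp: linear_order_on_def total_on_def)
  define w where "w \<delta> n = (if n \<in> \<Delta> \<and> (n, \<delta>) \<in> r then (1/2)^n else 0 :: real)" for \<delta> n
  define \<phi> where "\<phi> \<delta> = (\<Sum>n. w \<delta> n)" for \<delta>
  have half: "summable (\<lambda>n. (1/2)^n :: real)" by (simp add: summable_geometric)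
  have w0: "0 \<le> w \<delta> n" for \<delta> n by (simp add: w_def)
  have w1: "w \<delta> n \<le> (1/2)^n" for \<delta> n by (simp add: w_def)
  have summ: "summable (w \<delta>)" for \<delta>
    by (rule summable_comparison_test[OF _ half]) (use w0 w1 in auto)
  have pos: "0 < \<phi> \<delta>" if "\<delta> \<in> \<Delta>" for \<delta>
    unfolding \<phi>_def
    by (rule suminf_pos2[OF summ w0, of _ \<delta>]) (simp add: w_def that refl)
  have mono: "\<phi> \<delta> \<le> \<phi> \<gamma>" if "(\<delta>, \<gamma>) \<in> r" for \<delta> \<gamma>
    unfolding \<phi>_def
    by (rule suminf_le[OF _ summ summ]) (use trans[OF _ that] in \<open>auto simp: w_def\<close>)
  have strict: "\<phi> \<gamma> < \<phi> \<delta>" if "\<delta> \<in> \<Delta>" "(\<gamma>, \<delta>) \<in> r" "(\<delta>, \<gamma>) \<notin> r" for \<delta> \<gamma>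
  proof -
    \<comment> \<open>Every term of \<open>\<phi> \<gamma>\<close> also occurs in
      \<open>\<phi> \<delta>\<close>, and the term at \<open>\<delta>\<close> itself occurs only in
      the latter.\<close>
    have "0 < (\<Sum>n. w \<delta> n - w \<gamma> n)"
    proof (rule suminf_pos2[of _ \<delta>])
      show "summable (\<lambda>n. w \<delta> n - w \<gamma> n)" by (intro summable_diff summ)
      show "0 \<le> w \<delta> n - w \<gamma> n" for n using trans[OF _ that(2), of n] by (auto simp: w_def)
      show "0 < w \<delta> \<delta> - w \<gamma> \<delta>" using that refl by (simp add: w_def)
    qed
    then show ?thesis unfolding \<phi>_def by (simp add: suminf_diff[OF summ summ, symmetric])
  qed
  have le_iff: "\<phi> \<delta> \<le> \<phi> \<gamma> \<longleftrightarrow> (\<delta>, \<gamma>) \<in> r" if "\<delta> \<in> \<Delta>" "\<gamma> \<in> \<Delta>" for \<delta> \<gamma>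
    using mono[of \<delta> \<gamma>] strict[of \<delta> \<gamma>] total[OF that] that by (meson not_less)
  have "\<exists>\<gamma>\<in>\<Delta>. \<phi> \<gamma> < e \<or> (\<forall>\<delta>\<in>\<Delta>. \<phi> \<gamma> \<le> \<phi> \<delta>)" if e: "e > 0" for e
  proof (rule ccontr)
    assume "\<not> ?thesis"
    then have big: "\<And>\<gamma>. \<gamma> \<in> \<Delta> \<Longrightarrow> e \<le> \<phi> \<gamma>" and unb: "\<And>\<gamma>. \<gamma> \<in> \<Delta> \<Longrightarrow> \<exists>\<delta>\<in>\<Delta>. \<phi> \<delta> < \<phi> \<gamma>"
      by (auto simp: not_less not_le)
    \<comment> \<open>The choice of \<open>k\<close> makes the tail of the geometric series from
      \<open>k\<close> on, which is \<open>2 * (1/2)^k\<close>, smaller than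
      \<open>e\<close>.\<close>
    obtain k where k: "(1/2::real)^k < e/2" using real_arch_pow_inv[of "e/2" "1/2"] e by auto
    \<comment> \<open>As no value is least, some \<open>\<gamma>\<close> has a value below those of
      the finitely many elements of \<open>\<Delta>\<close> that are numerically smaller than
      \<open>k\<close>; none of these then contributes to \<open>\<phi> \<gamma>\<close>.\<close>
    obtain \<gamma> where \<gamma>: "\<gamma> \<in> \<Delta>" "\<forall>n\<in>\<Delta> \<inter> {..<k}. \<phi> \<gamma> < \<phi> n"
    proof (cases "\<Delta> \<inter> {..<k} = {}")
      case True
      then show ?thesis using that sk by (auto simp: countable_skeleton_def)
    next
      case False
      define m where "m = Min (\<phi> ` (\<Delta> \<inter> {..<k}))"
      have fin: "finite (\<phi> ` (\<Delta> \<inter> {..<k}))" by simp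
      have "m \<in> \<phi> ` (\<Delta> \<inter> {..<k})" unfolding m_def by (rule Min_in[OF fin]) (use False in simp)
      then obtain \<delta> where "\<delta> \<in> \<Delta>" "\<phi> \<delta> < m" using unb by auto
      moreover have "m \<le> \<phi> n" if "n \<in> \<Delta> \<inter> {..<k}" for n
        unfolding m_def using fin that by (intro Min_le) auto
      ultimately show ?thesis using that[of \<delta>] by force
    qed
    have "w \<gamma> n = 0" if n: "n < k" for n
    proof (cases "n \<in> \<Delta>")
      case True
      then have "\<not> \<phi> n \<le> \<phi> \<gamma>" using \<gamma>(2) n by (auto simp: not_le)
      then show ?thesis using \<gamma>(1) True le_iff by (simp add: w_def)
    qed (simp add: w_def)
    then have "(\<Sum>n<k. w \<gamma> n) = 0" by simp
    then have "\<phi> \<gamma> = (\<Sum>n. w \<gamma> (n + k))"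
      using suminf_split_initial_segment[OF summ, of \<gamma> k] by (simp add: \<phi>_def)
    also have "\<dots> \<le> (\<Sum>n. (1/2)^k * (1/2)^n)"
    proof (rule suminf_le)
      show "w \<gamma> (n + k) \<le> (1/2)^k * (1/2)^n" for n
        using w1[of \<gamma> "n + k"] by (simp add: power_add mult.commute)
    qed (intro summable_ignore_initial_segment summable_mult summ half)+
    also have "\<dots> = (1/2)^k * 2" by (simp add: suminf_mult[OF half] suminf_geometric)
    finally show False using k big[OF \<gamma>(1)] by linarith
  qed
  with pos le_iff show ?thesis by (intro that[of \<phi>]) simp_all
qed


section \<open>Isometry groups as generalized wreath products\<close>

lemma Iso_isomorphic_if_distance_set_eq:
  assumes "Polish_ultrametric U" "homogeneous U" "wide U" "mspace U \<noteq> {}"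
    and "Polish_ultrametric V" "homogeneous V" "wide V" "mspace V \<noteq> {}"
    and "distance_set U = distance_set V"
  shows "top_group_isomorphic (Iso_group U) (Iso_topology U) (Iso_group V) (Iso_topology V)"
proof -
  have "iso_rel U V {}" by (simp add: iso_rel_def)
  then obtain F F' where "isometry_pair U V F F'"
    using homogeneous_wide_isometric[OF assms, of "{}"] by auto
  then show ?thesis by (rule isometric_imp_Iso_isomorphic)
qed

text \<open>The set of levels \<open>X\<close> has two uses: the distances together with added small
  values give a quasi-maximal skeleton, and arbitrarily small distances alone give a maximal one. In
  both cases the model space has the same distances as \<open>U\<close>, and these determine the
  isometry group.\<close>

lemma Iso_isomorphic_Wr_LF:
  assumes U: "Polish_ultrametric U" "homogeneous U" "wide U" "mspace U \<noteq> {}"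
    and X: "countable X" "distance_set U \<subseteq> X" "\<And>x. x \<in> X \<Longrightarrow> 0 < x" "\<And>e. e > 0 \<Longrightarrow> \<exists>x\<in>X. x < e"
  obtains \<Delta> :: "nat set" and r N where
    "countable_skeleton \<Delta> r N" "linear_order_on \<Delta> r" "quasi_maximal_skeleton \<Delta> N"
    "X = distance_set U \<longrightarrow> maximal_skeleton \<Delta> N"
    "top_group_isomorphic (Iso_group U) (Iso_topology U)
       (Wr_group (LF \<Delta> r) \<Delta> r N) (Wr_topology (LF \<Delta> r) \<Delta> r N)"
proof -
  have ne: "X \<noteq> {}" using X(4)[of 1] by auto
  obtain \<Delta> :: "nat set" and r N \<phi> where
    sk: "countable_skeleton \<Delta> r N" "linear_order_on \<Delta> r" "quasi_maximal_skeleton \<Delta> N"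
    and \<phi>: "\<phi> ` \<Delta> = X" "\<phi> ` {\<delta> \<in> \<Delta>. N \<delta> = \<infinity>} = distance_set U"
      "\<forall>\<delta>\<in>\<Delta>. \<forall>\<gamma>\<in>\<Delta>. \<phi> \<delta> \<le> \<phi> \<gamma> \<longleftrightarrow> (\<delta>, \<gamma>) \<in> r"
    by (rule real_skeleton[OF X(1) ne X(2)])
  interpret M: skeleton_metric \<Delta> r N "LF \<Delta> r" \<phi>
  proof
    show "0 < \<phi> \<delta>" if "\<delta> \<in> \<Delta>" for \<delta> using X(3) \<phi>(1) that by blast
  qed (use sk \<phi>(3) in auto)
  have fine: "\<exists>\<gamma>\<in>\<Delta>. \<phi> \<gamma> < e \<or> (\<forall>\<delta>\<in>\<Delta>. \<phi> \<gamma> \<le> \<phi> \<delta>)" if "e > 0" for e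
    using X(4)[OF that] \<phi>(1) by blast
  have "Polish_ultrametric M.K" by (rule M.LF_Polish[OF refl fine])
  then have "top_group_isomorphic (Iso_group U) (Iso_topology U) (Iso_group M.K) (Iso_topology M.K)"
    using U M.homogeneous_K M.wide_K M.zero_in_S M.distance_set_K \<phi>(2)
    by (intro Iso_isomorphic_if_distance_set_eq) auto
  moreover have "Iso_topology M.K = Wr_topology (LF \<Delta> r) \<Delta> r N" by (rule M.Iso_topology_K_LF[OF fine])
  moreover have "maximal_skeleton \<Delta> N" if "X = distance_set U"
    unfolding maximal_skeleton_def
  proof
    fix \<delta> assume \<delta>: "\<delta> \<in> \<Delta>"
    then have "\<phi> \<delta> \<in> \<phi> ` {\<delta> \<in> \<Delta>. N \<delta> = \<infinity>}" using \<phi>(1,2) that by auto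
    then show "N \<delta> = \<infinity>" using M.\<phi>_inj \<delta> by auto
  qed
  ultimately show ?thesis using that sk by (simp add: M.Iso_group_K)
qed

text \<open>When distances are bounded away from 0, the finitely supported model over exactly these
  levels is complete. No level is added, so every \<open>N \<delta>\<close> is infinite.\<close>

lemma Iso_isomorphic_Wr_Fin:
  assumes U: "Polish_ultrametric U" "homogeneous U" "wide U"
    and D: "distance_set U \<noteq> {}" and c: "0 < c" "\<And>x. x \<in> distance_set U \<Longrightarrow> c \<le> x"
  obtains \<Delta> :: "nat set" and r N where
    "countable_skeleton \<Delta> r N" "linear_order_on \<Delta> r" "maximal_skeleton \<Delta> N"
    "top_group_isomorphic (Iso_group U) (Iso_topology U) (Wr_group (Fin \<Delta>) \<Delta> r N) (tau_star \<Delta> r N)"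
proof -
  obtain \<Delta> :: "nat set" and r N \<phi> where
    sk: "countable_skeleton \<Delta> r N" "linear_order_on \<Delta> r" "quasi_maximal_skeleton \<Delta> N"
    and \<phi>: "\<phi> ` \<Delta> = distance_set U" "\<phi> ` {\<delta> \<in> \<Delta>. N \<delta> = \<infinity>} = distance_set U"
      "\<forall>\<delta>\<in>\<Delta>. \<forall>\<gamma>\<in>\<Delta>. \<phi> \<delta> \<le> \<phi> \<gamma> \<longleftrightarrow> (\<delta>, \<gamma>) \<in> r"
    by (rule real_skeleton[OF Polish_ultrametric_countable_distance_set[OF U(1)] D order_refl])
  interpret M: skeleton_metric \<Delta> r N "Fin \<Delta>" \<phi>
  proof
    show "0 < \<phi> \<delta>" if "\<delta> \<in> \<Delta>" for \<delta> using distance_set_pos[of "\<phi> \<delta>" U] \<phi>(1) that by blast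
  qed (use sk \<phi>(3) in auto)
  have c': "c \<le> \<phi> \<delta>" if "\<delta> \<in> \<Delta>" for \<delta> using c(2) \<phi>(1) that by auto
  have "Polish_ultrametric M.K" by (rule M.Fin_Polish[OF refl c(1) c'])
  moreover have "mspace U \<noteq> {}" using D by (auto simp: distance_set_def)
  ultimately have "top_group_isomorphic (Iso_group U) (Iso_topology U) (Iso_group M.K) (Iso_topology M.K)"
    using U M.homogeneous_K M.wide_K M.zero_in_S M.distance_set_K \<phi>(2)
    by (intro Iso_isomorphic_if_distance_set_eq) auto
  moreover have "Iso_topology M.K = tau_star \<Delta> r N" by (rule M.Iso_topology_K_Fin[OF refl c(1) c'])
  moreover have "maximal_skeleton \<Delta> N"
    unfolding maximal_skeleton_def
  proof
    fix \<delta> assume \<delta>: "\<delta> \<in> \<Delta>"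
    then have "\<phi> \<delta> \<in> \<phi> ` {\<delta> \<in> \<Delta>. N \<delta> = \<infinity>}" using \<phi>(1,2) by auto
    then show "N \<delta> = \<infinity>" using M.\<phi>_inj \<delta> by auto
  qed
  ultimately show ?thesis using that sk by (simp add: M.Iso_group_K)
qed

text \<open>An order embedding of the skeleton into the positive reals puts a metric on the product
  itself, so groups and topologies come out equal rather than merely isomorphic.\<close>

lemma Wr_LF_eq_Iso:
  fixes \<Delta> :: "nat set"
  assumes "countable_skeleton \<Delta> r N" "linear_order_on \<Delta> r" "quasi_maximal_skeleton \<Delta> N"
  obtains U :: "(nat \<Rightarrow> nat) metric" where "Polish_ultrametric U" "homogeneous U" "wide U"
    "Iso_group U = Wr_group (LF \<Delta> r) \<Delta> r N" "Iso_topology U = Wr_topology (LF \<Delta> r) \<Delta> r N"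
proof -
  obtain \<phi> :: "nat \<Rightarrow> real" where \<phi>: "\<forall>\<delta>\<in>\<Delta>. 0 < \<phi> \<delta>"
    "\<forall>\<delta>\<in>\<Delta>. \<forall>\<gamma>\<in>\<Delta>. \<phi> \<delta> \<le> \<phi> \<gamma> \<longleftrightarrow> (\<delta>, \<gamma>) \<in> r"
    "\<forall>e>0. \<exists>\<gamma>\<in>\<Delta>. \<phi> \<gamma> < e \<or> (\<forall>\<delta>\<in>\<Delta>. \<phi> \<gamma> \<le> \<phi> \<delta>)"
    by (rule linear_skeleton_real_embedding[OF assms(1,2)])
  interpret M: skeleton_metric \<Delta> r N "LF \<Delta> r" \<phi>
    by standard (use assms \<phi> in auto)
  have fine: "\<exists>\<gamma>\<in>\<Delta>. \<phi> \<gamma> < e \<or> (\<forall>\<delta>\<in>\<Delta>. \<phi> \<gamma> \<le> \<phi> \<delta>)" if "e > 0" for e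
    using \<phi>(3) that by simp
  have "Polish_ultrametric M.K" by (rule M.LF_Polish[OF refl fine])
  moreover have "Iso_topology M.K = Wr_topology (LF \<Delta> r) \<Delta> r N" by (rule M.Iso_topology_K_LF[OF fine])
  ultimately show ?thesis by (intro that[of M.K] M.homogeneous_K M.wide_K M.Iso_group_K)
qed

lemma Wr_Fin_eq_Iso:
  fixes \<Delta> :: "nat set"
  assumes "countable_skeleton \<Delta> r N" "linear_order_on \<Delta> r" "quasi_maximal_skeleton \<Delta> N"
  obtains U :: "(nat \<Rightarrow> nat) metric" where "Polish_ultrametric U" "homogeneous U" "wide U"
    "Iso_group U = Wr_group (Fin \<Delta>) \<Delta> r N" "Iso_topology U = tau_star \<Delta> r N"
proof -
  obtain \<phi> :: "nat \<Rightarrow> real" where \<phi>: "\<forall>\<delta>\<in>\<Delta>. 0 < \<phi> \<delta>"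
    "\<forall>\<delta>\<in>\<Delta>. \<forall>\<gamma>\<in>\<Delta>. \<phi> \<delta> \<le> \<phi> \<gamma> \<longleftrightarrow> (\<delta>, \<gamma>) \<in> r"
    by (rule linear_skeleton_real_embedding[OF assms(1,2)])
  \<comment> \<open>Adding 1 keeps the order and bounds the values away from 0, which makes the
    space discrete and complete.\<close>
  interpret M: skeleton_metric \<Delta> r N "Fin \<Delta>" "\<lambda>\<delta>. \<phi> \<delta> + 1"
  proof
    show "0 < \<phi> \<delta> + 1" if "\<delta> \<in> \<Delta>" for \<delta> using \<phi>(1) that by (simp add: add_pos_pos)
  qed (use assms \<phi>(2) in auto)
  have c: "1 \<le> \<phi> \<delta> + 1" if "\<delta> \<in> \<Delta>" for \<delta> using \<phi>(1) that by (simp add: less_imp_le)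
  have "Polish_ultrametric M.K" by (rule M.Fin_Polish[OF refl zero_less_one c])
  moreover have "Iso_topology M.K = tau_star \<Delta> r N" by (rule M.Iso_topology_K_Fin[OF refl zero_less_one c])
  ultimately show ?thesis by (intro that[of M.K] M.homogeneous_K M.wide_K M.Iso_group_K)
qed

text \<open>For \<open>D = {e}\<close> this is a countably infinite equidistant space, used to test
  wideness. For \<open>D = {}\<close> it is a single point, whose isometry group is trivial.\<close>

lemma equidistant_space:
  assumes D: "D \<subseteq> {e}" and e: "0 < e"
  obtains U :: "(nat \<Rightarrow> nat) metric" where "Polish_ultrametric U" "homogeneous U" "wide U"
    "mspace U \<noteq> {}" "distance_set U = D"
proof -
  obtain \<Delta> :: "nat set" and r N \<phi> where
    sk: "countable_skeleton \<Delta> r N" "quasi_maximal_skeleton \<Delta> N"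
    and \<phi>: "\<phi> ` \<Delta> = {e}" "\<phi> ` {\<delta> \<in> \<Delta>. N \<delta> = \<infinity>} = D"
      "\<forall>\<delta>\<in>\<Delta>. \<forall>\<gamma>\<in>\<Delta>. \<phi> \<delta> \<le> \<phi> \<gamma> \<longleftrightarrow> (\<delta>, \<gamma>) \<in> r"
    by (rule real_skeleton[of "{e}", OF _ _ D]) simp_all
  have \<phi>e: "\<phi> \<delta> = e" if "\<delta> \<in> \<Delta>" for \<delta> using \<phi>(1) that by auto
  interpret M: skeleton_metric \<Delta> r N "Fin \<Delta>" \<phi>
    by standard (use sk \<phi> \<phi>e e in auto)
  have "Polish_ultrametric M.K" by (rule M.Fin_Polish[OF refl e]) (simp add: \<phi>e)
  then show ?thesis
    using that[of M.K] M.homogeneous_K M.wide_K M.zero_in_S M.distance_set_K \<phi>(2) by auto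
qed

section \<open>Urysohn spaces are homogeneous and wide\<close>

lemma Urysohn_homogeneous: "Urysohn U \<Longrightarrow> homogeneous U"
  unfolding homogeneous_def
proof (intro ballI)
  fix x y assume U: "Urysohn U" and xy: "x \<in> mspace U" "y \<in> mspace U"
  \<comment> \<open>A map between two one-point sets preserves distances, so ultrahomogeneity
    extends it.\<close>
  have "finite {x} \<and> {x} \<subseteq> mspace U \<and> finite {y} \<and> {y} \<subseteq> mspace U \<and>
      (\<lambda>_. y) ` {x} = {y} \<and> preserves_dist U U {x} (\<lambda>_. y)"
    using xy by (simp add: preserves_dist_def)
  moreover have "ultrahomogeneous U" using U by (simp add: Urysohn_def)
  ultimately have "\<exists>g\<in>isometries U. \<forall>z\<in>{x}. g z = (\<lambda>_. y) z"
    unfolding ultrahomogeneous_def by (elim allE impE)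
  then show "\<exists>g\<in>isometries U. g x = y" by simp
qed

text \<open>Universality embeds a space containing an infinite equidistant set with distance
  \<open>e\<close>; the image of that set is as wideness demands.\<close>

lemma Urysohn_wide:
  assumes U: "Urysohn U"
  shows "wide U"
  unfolding wide_def
proof
  fix e assume e: "e \<in> distance_set U"
  obtain X :: "(nat \<Rightarrow> nat) metric" where X: "Polish_ultrametric X" "wide X" "distance_set X = {e}"
    by (rule equidistant_space[OF subset_refl distance_set_pos[OF e]])
  then obtain f where f: "f \<in> mspace X \<rightarrow> mspace U" "preserves_dist X U (mspace X) f"
    using U e unfolding Urysohn_def by force
  obtain A where A: "A \<subseteq> mspace X" "countable A" "infinite A"
      "\<And>x y. x \<in> A \<Longrightarrow> y \<in> A \<Longrightarrow> x \<noteq> y \<Longrightarrow> mdist X x y = e"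
    using X(2,3) unfolding wide_def by auto
  have f_dist: "mdist U (f x) (f y) = mdist X x y" if "x \<in> A" "y \<in> A" for x y
    using f(2) A(1) that by (auto simp: preserves_dist_def)
  have "inj_on f A"
  proof (rule inj_onI)
    fix x y assume xy: "x \<in> A" "y \<in> A" "f x = f y"
    have m: "x \<in> mspace X" "y \<in> mspace X" "f y \<in> mspace U" using A(1) f(1) xy by auto
    have "mdist X x y = mdist U (f x) (f y)" by (rule f_dist[OF xy(1,2), symmetric])
    also have "\<dots> = 0" unfolding xy(3) by (rule mdist_self) (rule m)
    finally show "x = y" using m by simp
  qed
  then have "infinite (f ` A)" using A(3) by (simp add: finite_image_iff)
  moreover have "mdist U u v = e" if uv: "u \<in> f ` A" "v \<in> f ` A" "u \<noteq> v" for u v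
  proof -
    obtain x y where "x \<in> A" "y \<in> A" "u = f x" "v = f y" using uv by auto
    then show ?thesis using uv(3) A(4)[of x y] f_dist[of x y] by auto
  qed
  moreover have "f ` A \<subseteq> mspace U" using A(1) f(1) by auto
  ultimately show "\<exists>A\<subseteq>mspace U. countable A \<and> infinite A \<and> (\<forall>x\<in>A. \<forall>y\<in>A. x \<noteq> y \<longrightarrow> mdist U x y = e)"
    using A(2) by (intro exI[of _ "f ` A"]) simp
qed

text \<open>Points in \<open>nat \<Rightarrow> nat\<close> represent all Polish ultrametric spaces
  up to isometry, and sets of naturals represent all countable skeletons up to relabelling. The
  trivial group is a separate alternative in the last condition because no maximal skeleton yields
  it.\<close>

theorem theorem6p7:
  fixes G :: "('a, 'm) monoid_scheme" and T :: "'a topology"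
  assumes "topological_group G T"
  shows
    "((\<exists>U :: (nat \<Rightarrow> nat) metric.
         Urysohn U \<and> top_group_isomorphic G T (Iso_group U) (Iso_topology U))
      \<longleftrightarrow>
      (\<exists>U :: (nat \<Rightarrow> nat) metric.
         Polish_ultrametric U \<and> homogeneous U \<and> wide U \<and>
         top_group_isomorphic G T (Iso_group U) (Iso_topology U)))
     \<and>
     ((\<exists>U :: (nat \<Rightarrow> nat) metric.
         Polish_ultrametric U \<and> homogeneous U \<and> wide U \<and>
         top_group_isomorphic G T (Iso_group U) (Iso_topology U))
      \<longleftrightarrow>
      (\<exists>(\<Delta> :: nat set) r N.
         countable_skeleton \<Delta> r N \<and> linear_order_on \<Delta> r \<and> quasi_maximal_skeleton \<Delta> N \<and>
         top_group_isomorphic G T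
           (Wr_group (LF \<Delta> r) \<Delta> r N) (Wr_topology (LF \<Delta> r) \<Delta> r N)))
     \<and>
     ((\<exists>(\<Delta> :: nat set) r N.
         countable_skeleton \<Delta> r N \<and> linear_order_on \<Delta> r \<and> quasi_maximal_skeleton \<Delta> N \<and>
         top_group_isomorphic G T
           (Wr_group (LF \<Delta> r) \<Delta> r N) (Wr_topology (LF \<Delta> r) \<Delta> r N))
      \<longleftrightarrow>
      ((\<exists>(\<Delta> :: nat set) r N.
          countable_skeleton \<Delta> r N \<and> linear_order_on \<Delta> r \<and> maximal_skeleton \<Delta> N \<and>
          (top_group_isomorphic G T
             (Wr_group (LF \<Delta> r) \<Delta> r N) (Wr_topology (LF \<Delta> r) \<Delta> r N) \<or>
           top_group_isomorphic G T
             (Wr_group (Fin \<Delta>) \<Delta> r N) (tau_star \<Delta> r N)))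
       \<or> carrier G = {\<one>\<^bsub>G\<^esub>}))"
  (is "(?A \<longleftrightarrow> ?B) \<and> (?B \<longleftrightarrow> ?C) \<and> (?C \<longleftrightarrow> ?D \<or> ?E)")
proof -
  \<comment> \<open>\<open>B'\<close> excludes the empty space, which is homogeneous and wide but
    contains no copy of a one-point space and hence is not Urysohn.\<close>
  define B' where "B' \<longleftrightarrow> (\<exists>U :: (nat \<Rightarrow> nat) metric.
         Polish_ultrametric U \<and> homogeneous U \<and> wide U \<and> mspace U \<noteq> {} \<and>
         top_group_isomorphic G T (Iso_group U) (Iso_topology U))"
  have EB': B' if E: ?E
  proof -
    obtain U :: "(nat \<Rightarrow> nat) metric" where "Polish_ultrametric U" "homogeneous U" "wide U"
      "mspace U \<noteq> {}" "distance_set U = {}"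
      by (rule equidistant_space[of "{}" 1]) simp_all
    moreover from this(5) have "top_group_isomorphic G T (Iso_group U) (Iso_topology U)"
      by (rule trivial_isomorphic_Iso[OF assms E])
    ultimately show ?thesis unfolding B'_def by blast
  qed
  have BB': B' if B: ?B
  proof -
    obtain U :: "(nat \<Rightarrow> nat) metric" where U: "Polish_ultrametric U" "homogeneous U" "wide U"
      "top_group_isomorphic G T (Iso_group U) (Iso_topology U)" using B by blast
    show ?thesis
    proof (cases "mspace U = {}")
      case True
      \<comment> \<open>The empty space has a trivial isometry group, so a one-point space can
        replace it.\<close>
      then have "distance_set U = {}" by (simp add: distance_set_def)
      then show ?thesis using isomorphic_Iso_trivial[OF assms _ U(4)] EB' by simp
    next
      case False
      then show ?thesis unfolding B'_def using U by blast
    qed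
  qed
  have AB: ?B if A: ?A
  proof -
    obtain U :: "(nat \<Rightarrow> nat) metric" where U: "Urysohn U"
      "top_group_isomorphic G T (Iso_group U) (Iso_topology U)" using A by blast
    then have "Polish_ultrametric U" by (simp add: Urysohn_def)
    then show ?thesis using U Urysohn_homogeneous[OF U(1)] Urysohn_wide[OF U(1)] by blast
  qed
  have B'A: ?A if B'
    using that homogeneous_wide_Urysohn unfolding B'_def by blast
  have CB: ?B if C: ?C
  proof -
    obtain \<Delta> :: "nat set" and r N where
      sk: "countable_skeleton \<Delta> r N" "linear_order_on \<Delta> r" "quasi_maximal_skeleton \<Delta> N"
      and G: "top_group_isomorphic G T (Wr_group (LF \<Delta> r) \<Delta> r N) (Wr_topology (LF \<Delta> r) \<Delta> r N)"
      using C by blast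
    obtain U :: "(nat \<Rightarrow> nat) metric" where "Polish_ultrametric U" "homogeneous U" "wide U"
      "Iso_group U = Wr_group (LF \<Delta> r) \<Delta> r N" "Iso_topology U = Wr_topology (LF \<Delta> r) \<Delta> r N"
      by (rule Wr_LF_eq_Iso[OF sk])
    then show ?thesis using G by (intro exI[of _ U]) simp
  qed
  have B'C: ?C if B: B'
  proof -
    obtain U :: "(nat \<Rightarrow> nat) metric" where U: "Polish_ultrametric U" "homogeneous U" "wide U"
      "mspace U \<noteq> {}" and G: "top_group_isomorphic G T (Iso_group U) (Iso_topology U)"
      using B unfolding B'_def by blast
    \<comment> \<open>The added values, which receive \<open>N \<delta> = 1\<close>, ensure that
      there are arbitrarily small levels whatever the distances are.\<close>
    define X where "X = distance_set U \<union> range (\<lambda>n. inverse (real (Suc n)))"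
    have X: "countable X" "distance_set U \<subseteq> X"
      using Polish_ultrametric_countable_distance_set[OF U(1)] by (auto simp: X_def)
    have pos: "0 < x" if "x \<in> X" for x using that distance_set_pos by (auto simp: X_def)
    have small: "\<exists>x\<in>X. x < e" if e: "e > 0" for e
    proof -
      obtain n where "inverse (real (Suc n)) < e" using reals_Archimedean[OF e] by blast
      then show ?thesis by (intro bexI[of _ "inverse (real (Suc n))"]) (auto simp: X_def)
    qed
    obtain \<Delta> :: "nat set" and r N where
      "countable_skeleton \<Delta> r N" "linear_order_on \<Delta> r" "quasi_maximal_skeleton \<Delta> N"
      "top_group_isomorphic (Iso_group U) (Iso_topology U)
         (Wr_group (LF \<Delta> r) \<Delta> r N) (Wr_topology (LF \<Delta> r) \<Delta> r N)"
      by (rule Iso_isomorphic_Wr_LF[OF U X pos small])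
    then show ?thesis using top_group_isomorphic_trans[OF G] by blast
  qed
  have DB: ?B if D: ?D
  proof -
    obtain \<Delta> :: "nat set" and r N where
      sk: "countable_skeleton \<Delta> r N" "linear_order_on \<Delta> r" "maximal_skeleton \<Delta> N"
      and G: "top_group_isomorphic G T (Wr_group (LF \<Delta> r) \<Delta> r N) (Wr_topology (LF \<Delta> r) \<Delta> r N) \<or>
        top_group_isomorphic G T (Wr_group (Fin \<Delta>) \<Delta> r N) (tau_star \<Delta> r N)"
      using D by blast
    have qm: "quasi_maximal_skeleton \<Delta> N"
      using sk(3) by (simp add: maximal_skeleton_def quasi_maximal_skeleton_def)
    from G show ?thesis
    proof
      assume "top_group_isomorphic G T (Wr_group (LF \<Delta> r) \<Delta> r N) (Wr_topology (LF \<Delta> r) \<Delta> r N)"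
      then have ?C using sk qm by blast
      then show ?B by (rule CB)
    next
      assume G: "top_group_isomorphic G T (Wr_group (Fin \<Delta>) \<Delta> r N) (tau_star \<Delta> r N)"
      obtain U :: "(nat \<Rightarrow> nat) metric" where "Polish_ultrametric U" "homogeneous U" "wide U"
        "Iso_group U = Wr_group (Fin \<Delta>) \<Delta> r N" "Iso_topology U = tau_star \<Delta> r N"
        by (rule Wr_Fin_eq_Iso[OF sk(1,2) qm])
      then show ?B using G by (intro exI[of _ U]) simp
    qed
  qed
  have B'D: "?D \<or> ?E" if B: B'
  proof -
    obtain U :: "(nat \<Rightarrow> nat) metric" where U: "Polish_ultrametric U" "homogeneous U" "wide U"
      "mspace U \<noteq> {}" and G: "top_group_isomorphic G T (Iso_group U) (Iso_topology U)"
      using B unfolding B'_def by blast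
    \<comment> \<open>No distances give the trivial group, arbitrarily small ones the
      \<open>LF\<close> product, and distances bounded away from 0 the \<open>Fin\<close> product
      with \<open>tau_star\<close>.\<close>
    consider "distance_set U = {}"
      | "\<And>e. e > 0 \<Longrightarrow> \<exists>x\<in>distance_set U. x < e"
      | c where "distance_set U \<noteq> {}" "0 < c" "\<And>x. x \<in> distance_set U \<Longrightarrow> c \<le> x"
      by (metis not_less)
    then show ?thesis
    proof cases
      case 1
      then show ?thesis using isomorphic_Iso_trivial[OF assms _ G] by simp
    next
      case 2
      have pos: "0 < x" if "x \<in> distance_set U" for x using that by (rule distance_set_pos)
      obtain \<Delta> :: "nat set" and r N where
        "countable_skeleton \<Delta> r N" "linear_order_on \<Delta> r" "quasi_maximal_skeleton \<Delta> N"
        "distance_set U = distance_set U \<longrightarrow> maximal_skeleton \<Delta> N"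
        "top_group_isomorphic (Iso_group U) (Iso_topology U)
           (Wr_group (LF \<Delta> r) \<Delta> r N) (Wr_topology (LF \<Delta> r) \<Delta> r N)"
        by (rule Iso_isomorphic_Wr_LF[OF U Polish_ultrametric_countable_distance_set[OF U(1)] order_refl pos 2])
      then show ?thesis using top_group_isomorphic_trans[OF G] by blast
    next
      case 3
      obtain \<Delta> :: "nat set" and r N where
        "countable_skeleton \<Delta> r N" "linear_order_on \<Delta> r" "maximal_skeleton \<Delta> N"
        "top_group_isomorphic (Iso_group U) (Iso_topology U) (Wr_group (Fin \<Delta>) \<Delta> r N) (tau_star \<Delta> r N)"
        by (rule Iso_isomorphic_Wr_Fin[OF U(1-3) 3])
      then show ?thesis using top_group_isomorphic_trans[OF G] by blast
    qed
  qed
  have "?A \<longleftrightarrow> ?B" using AB B'A BB' by blast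
  moreover have BC: "?B \<longleftrightarrow> ?C" using BB' B'C CB by blast
  moreover have "?B \<longleftrightarrow> ?D \<or> ?E"
    using BB' B'D DB EB' B'C CB by blast
  ultimately show ?thesis by argo
qed

end
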